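(* Assume (H8) and (H9). For every $x\in E$ and $t_0\ge0$, $$\frac{d\mathrm P_x^{(B,t)}}{d\mathrm P_x}\bigg|_{\mathcal D_{t_0}}\xrightarrow[t\to+\infty]{}\frac{d\mathrm P_x^{\phi_0}}{d\mathrm P_x}\bigg|_{\mathcal D_{t_0}}\qquad\mathrm P_x\text{-a.s. and in }L^1(\mathrm P_x),$$ where the left-hand side is considered for $t\ge t_0$.
   Context: $C_b$ denotes the bounded continuous real functions on the state space $E$. $Y$ is the canonical process on $D(\mathbb R_+,E)$ (càdlàg paths), $\mathcal D_t$ its canonical right-continuous filtration, and $(\mathrm P_x)_{x\in E}$ a Borel strong Markov process (expectation $\mathrm E_x$) whose semigroup maps $C_b$ to $C_b$. Its generator $\mathcal L$: $f\in\mathrm{Dom}(\mathcal L)$ iff $f\in C_b$ and there is $g\in C_b$ such that $f(Y_t)-f(x)-\int_0^tg(Y_s)ds$ is a $\mathrm P_x$-martingale for all $x$; then $\mathcal Lf=g$. Moreover $Y$ is either (a) an irreducible continuous-time Markov chain on a finite set $E=\{1,\dots,K\}$, or (b) a diffusion on a domain $E\subset\mathbb R^K$ with generator $\mathcal Lu=\sum_ib_i\partial_{x_i}u+\frac12\sum_{i,j}a_{ij}\partial_{x_ix_j}u$, where $a_{ij},b_i\in C^{1,\mu}(E)$ (first-order derivatives locally Hölder with exponent $\mu\in[0,1)$) and $(a_{ij})$ is positive definite. $\beta\in C_b$. $\lambda_0=\sup\{\ell\in\mathbb R:\exists u\in\mathrm{Dom}(\mathcal L),u>0,(\beta-\mathcal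 L)u=\ell u\}$ (no sign restriction); the space of positive harmonic functions of $(\beta-\lambda_0)-\mathcal L$ is assumed one-dimensional, generated by $\phi_0>0$, so $(\beta-\mathcal L)\phi_0=\lambda_0\phi_0$. (H8) $\phi_0\in\mathrm{Dom}(\mathcal L)$ and $C_1\le\phi_0\le C_2$ for some positive constants $C_1,C_2$; then $\mathrm P_x^{\phi_0}$ (expectation $\mathrm E_x^{\phi_0}$) is defined by $\frac{d\mathrm P_x^{\phi_0}}{d\mathrm P_x}\big|_{\mathcal D_t}=\frac{\phi_0(Y_t)}{\phi_0(Y_0)}e^{-\int_0^t(\beta(Y_s)-\lambda_0)ds}$, $t\ge0$. (H9) $\mathrm P^{\phi_0}$ admits a stationary probability measure $\pi$, and for every $x\in E$, $\sup_{\|f\|_\infty\le1}|\mathrm E_x^{\phi_0}[f(Y_t)]-\pi(f)|\to0$ as $t\to\infty$ (supremum over bounded measurable $f$). For $t\ge0$, $\mathrm P_x^{(B,t)}$ is the probability measure on $\mathcal D_t$ with $\frac{d\mathrm P_x^{(B,t)}}{d\mathrm P_x}\big|_{\mathcal D_t}=\frac{e^{-\int_0^t\beta(Y_s)ds}}{\mathrm E_x[e^{-\int_0^t\beta(Y_s)ds}]}$. *)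

theory Defs
  imports "HOL-Probability.Probability"
begin

section \<open>Path space and canonical filtration\<close>

text \<open>The state space \<open>E\<close> is a subset of a topological type with the subspace topology. Functions
  on \<open>E\<close> are total functions of which only the values on \<open>E\<close> matter. The canonical process is
  \<open>Y\<^sub>t \<omega> = \<omega> t\<close>; paths are normalised to be \<open>undefined\<close> at negative times.\<close>

definition cadlag_paths :: "'e::topological_space set \<Rightarrow> (real \<Rightarrow> 'e) set" where
  "cadlag_paths E = {\<omega> \<in> {0..} \<rightarrow>\<^sub>E E.
     (\<forall>t\<ge>0. (\<omega> \<longlongrightarrow> \<omega> t) (at_right t)) \<and>
     (\<forall>t>0. \<exists>l\<in>E. (\<omega> \<longlongrightarrow> l) (at_left t))}"

definition shift :: "real \<Rightarrow> (real \<Rightarrow> 'e) \<Rightarrow> (real \<Rightarrow> 'e)" where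
  "shift s \<omega> = restrict (\<lambda>t. \<omega> (s + t)) {0..}"

definition raw_filtration :: "'e::topological_space set \<Rightarrow> ennreal \<Rightarrow> (real \<Rightarrow> 'e) measure" where
  "raw_filtration E t = sigma (cadlag_paths E)
     {{\<omega> \<in> cadlag_paths E. \<omega> r \<in> B} | r B. 0 \<le> r \<and> ennreal r \<le> t \<and> B \<in> sets borel}"

text \<open>Times range over \<open>[0, \<infinity>]\<close> so that the library's stopping times apply. For \<open>t < \<infinity>\<close> this is
  the intersection of the raw \<open>\<sigma>\<close>-algebras over \<open>s > t\<close>; for \<open>t = \<infinity>\<close> it is the
  \<open>\<sigma>\<close>-algebra generated by the whole path.\<close>

definition path_filtration :: "'e::topological_space set \<Rightarrow> ennreal \<Rightarrow> (real \<Rightarrow> 'e) measure" where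
  "path_filtration E t = sigma (cadlag_paths E)
     (\<Inter>s\<in>{s. t < s \<or> s = \<infinity>}. sets (raw_filtration E s))"

definition path_integral :: "('e \<Rightarrow> real) \<Rightarrow> real \<Rightarrow> (real \<Rightarrow> 'e) \<Rightarrow> real" where
  "path_integral V t \<omega> = (LBINT s:{0..t}. V (\<omega> s))"


section \<open>Feller strong Markov processes and their generators\<close>

definition Cb :: "'e::topological_space set \<Rightarrow> ('e \<Rightarrow> real) set" where
  "Cb E = {f. continuous_on E f \<and> bounded (f ` E)}"

definition strong_markov ::
  "'e::topological_space set \<Rightarrow> ('e \<Rightarrow> (real \<Rightarrow> 'e) measure) \<Rightarrow> bool" where
  "strong_markov E P \<longleftrightarrow>
     P \<in> restrict_space borel E \<rightarrow>\<^sub>M prob_algebra (path_filtration E \<infinity>) \<and>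
     (\<forall>x\<in>E. AE \<omega> in P x. \<omega> 0 = x) \<and>
     (\<forall>x\<in>E. \<forall>T F. stopping_time (path_filtration E) T \<longrightarrow>
        F \<in> borel_measurable (path_filtration E \<infinity>) \<longrightarrow> bounded (F ` cadlag_paths E) \<longrightarrow>
        (AE \<omega> in P x. T \<omega> < \<infinity> \<longrightarrow>
           real_cond_exp (P x) (filtration.pre_sigma (cadlag_paths E) (path_filtration E) T)
             (\<lambda>\<omega>. F (shift (enn2real (T \<omega>)) \<omega>)) \<omega>
           = (\<integral>\<eta>. F \<eta> \<partial>P (\<omega> (enn2real (T \<omega>))))))"

definition Cb_feller ::
  "'e::topological_space set \<Rightarrow> ('e \<Rightarrow> (real \<Rightarrow> 'e) measure) \<Rightarrow> bool" where
  "Cb_feller E P \<longleftrightarrow> (\<forall>f\<in>Cb E. \<forall>t\<ge>0. (\<lambda>x. \<integral>\<omega>. f (\<omega> t) \<partial>P x) \<in> Cb E)"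

definition path_martingale ::
  "'e::topological_space set \<Rightarrow> (real \<Rightarrow> 'e) measure \<Rightarrow> (real \<Rightarrow> (real \<Rightarrow> 'e) \<Rightarrow> real) \<Rightarrow> bool" where
  "path_martingale E M X \<longleftrightarrow>
     (\<forall>t\<ge>0. X t \<in> borel_measurable (path_filtration E (ennreal t)) \<and> integrable M (X t)) \<and>
     (\<forall>s t. 0 \<le> s \<longrightarrow> s \<le> t \<longrightarrow>
        (AE \<omega> in M. real_cond_exp M (path_filtration E (ennreal s)) (X t) \<omega> = X s \<omega>))"

text \<open>\<open>is_generator E P f g\<close> says that \<open>f\<close> is in the domain of the generator, with image \<open>g\<close>.\<close>

definition is_generator ::
  "'e::topological_space set \<Rightarrow> ('e \<Rightarrow> (real \<Rightarrow> 'e) measure) \<Rightarrow> ('e \<Rightarrow> real) \<Rightarrow> ('e \<Rightarrow> real) \<Rightarrow> bool" where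
  "is_generator E P f g \<longleftrightarrow> f \<in> Cb E \<and> g \<in> Cb E \<and>
     (\<forall>x\<in>E. path_martingale E (P x) (\<lambda>t \<omega>. f (\<omega> t) - f x - path_integral g t \<omega>))"

definition generator_domain ::
  "'e::topological_space set \<Rightarrow> ('e \<Rightarrow> (real \<Rightarrow> 'e) measure) \<Rightarrow> ('e \<Rightarrow> real) set" where
  "generator_domain E P = {f. \<exists>g. is_generator E P f g}"


section \<open>The two classes of processes\<close>

definition irreducible_chain :: "nat \<Rightarrow> (nat \<Rightarrow> (real \<Rightarrow> nat) measure) \<Rightarrow> bool" where
  "irreducible_chain K P \<longleftrightarrow> 1 \<le> K \<and> strong_markov {1..K} P \<and>
     (\<forall>i\<in>{1..K}. \<forall>j\<in>{1..K}. \<exists>t\<ge>0. measure (P i) {\<omega> \<in> cadlag_paths {1..K}. \<omega> t = j} > 0)"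

definition partial :: "'k \<Rightarrow> (real ^ 'k::finite \<Rightarrow> real) \<Rightarrow> real ^ 'k \<Rightarrow> real" where
  "partial i f x = frechet_derivative f (at x) (axis i 1)"

definition C1_on :: "(real ^ 'k::finite) set \<Rightarrow> (real ^ 'k \<Rightarrow> real) \<Rightarrow> bool" where
  "C1_on E f \<longleftrightarrow> (\<forall>x\<in>E. f differentiable (at x)) \<and> (\<forall>i. continuous_on E (partial i f))"

definition C2_on :: "(real ^ 'k::finite) set \<Rightarrow> (real ^ 'k \<Rightarrow> real) \<Rightarrow> bool" where
  "C2_on E f \<longleftrightarrow> C1_on E f \<and> (\<forall>i. C1_on E (partial i f))"

definition C1_holder_on :: "(real ^ 'k::finite) set \<Rightarrow> real \<Rightarrow> (real ^ 'k \<Rightarrow> real) \<Rightarrow> bool" where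
  "C1_holder_on E \<mu> f \<longleftrightarrow> C1_on E f \<and>
     (\<forall>i S. compact S \<longrightarrow> S \<subseteq> E \<longrightarrow>
        (\<exists>C. \<forall>x\<in>S. \<forall>y\<in>S. \<bar>partial i f x - partial i f y\<bar> \<le> C * dist x y powr \<mu>))"

definition elliptic_operator ::
  "(real ^ 'k::finite \<Rightarrow> real ^ 'k ^ 'k) \<Rightarrow> (real ^ 'k \<Rightarrow> real ^ 'k) \<Rightarrow>
   (real ^ 'k \<Rightarrow> real) \<Rightarrow> real ^ 'k \<Rightarrow> real" where
  "elliptic_operator a b u x =
     (\<Sum>i\<in>UNIV. b x $ i * partial i u x) +
     1 / 2 * (\<Sum>i\<in>UNIV. \<Sum>j\<in>UNIV. a x $ i $ j * partial i (partial j u) x)"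

text \<open>A diffusion has continuous paths, and \<open>elliptic_operator a b\<close> is its generator on bounded \<open>C\<^sup>2\<close>
  functions with bounded continuous image. No compact support is needed: paths stay in \<open>E\<close>, so
  by localisation this amounts to the same condition for compactly supported \<open>C\<^sup>2\<close> functions.\<close>

definition diffusion_on ::
  "(real ^ 'k::finite) set \<Rightarrow> real \<Rightarrow> (real ^ 'k \<Rightarrow> real ^ 'k ^ 'k) \<Rightarrow> (real ^ 'k \<Rightarrow> real ^ 'k) \<Rightarrow>
   (real ^ 'k \<Rightarrow> (real \<Rightarrow> real ^ 'k) measure) \<Rightarrow> bool" where
  "diffusion_on E \<mu> a b P \<longleftrightarrow>
     open E \<and> connected E \<and> E \<noteq> {} \<and> 0 \<le> \<mu> \<and> \<mu> < 1 \<and>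
     (\<forall>i j. C1_holder_on E \<mu> (\<lambda>x. a x $ i $ j)) \<and>
     (\<forall>i. C1_holder_on E \<mu> (\<lambda>x. b x $ i)) \<and>
     (\<forall>x\<in>E. transpose (a x) = a x \<and> (\<forall>v. v \<noteq> 0 \<longrightarrow> v \<bullet> (a x *v v) > 0)) \<and>
     strong_markov E P \<and>
     (\<forall>x\<in>E. AE \<omega> in P x. continuous_on {0..} \<omega>) \<and>
     (\<forall>u g. u \<in> Cb E \<longrightarrow> g \<in> Cb E \<longrightarrow> C2_on E u \<longrightarrow>
        (is_generator E P u g \<longleftrightarrow> (\<forall>x\<in>E. g x = elliptic_operator a b u x)))"


section \<open>Ground state\<close>

definition is_eigenfunction ::
  "'e::topological_space set \<Rightarrow> ('e \<Rightarrow> (real \<Rightarrow> 'e) measure) \<Rightarrow> ('e \<Rightarrow> real) \<Rightarrow> real \<Rightarrow> ('e \<Rightarrow> real) \<Rightarrow> bool" where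
  "is_eigenfunction E P \<beta> l u \<longleftrightarrow>
     (\<exists>g. is_generator E P u g \<and> (\<forall>x\<in>E. \<beta> x * u x - g x = l * u x))"

definition is_lambda_zero ::
  "'e::topological_space set \<Rightarrow> ('e \<Rightarrow> (real \<Rightarrow> 'e) measure) \<Rightarrow> ('e \<Rightarrow> real) \<Rightarrow> real \<Rightarrow> bool" where
  "is_lambda_zero E P \<beta> l0 \<longleftrightarrow>
     ereal l0 = (SUP l\<in>{l. \<exists>u. (\<forall>x\<in>E. u x > 0) \<and> is_eigenfunction E P \<beta> l u}. ereal l)"

text \<open>\<open>u > 0\<close> and \<open>V u - \<L> u = 0\<close>, where \<open>\<L>\<close> is the generator on its domain.\<close>

definition positive_harmonic ::
  "'e::topological_space set \<Rightarrow> ('e \<Rightarrow> (real \<Rightarrow> 'e) measure) \<Rightarrow> ('e \<Rightarrow> real) \<Rightarrow> ('e \<Rightarrow> real) \<Rightarrow> bool" where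
  "positive_harmonic E P V u \<longleftrightarrow> (\<forall>x\<in>E. u x > 0) \<and> is_eigenfunction E P V 0 u"

definition ground_state ::
  "'e::topological_space set \<Rightarrow> ('e \<Rightarrow> (real \<Rightarrow> 'e) measure) \<Rightarrow> ('e \<Rightarrow> real) \<Rightarrow> real \<Rightarrow> ('e \<Rightarrow> real) \<Rightarrow> bool" where
  "ground_state E P \<beta> l0 \<phi>0 \<longleftrightarrow> is_lambda_zero E P \<beta> l0 \<and>
     positive_harmonic E P (\<lambda>x. \<beta> x - l0) \<phi>0 \<and>
     (\<forall>u. positive_harmonic E P (\<lambda>x. \<beta> x - l0) u \<longrightarrow> (\<exists>c. \<forall>x\<in>E. u x = c * \<phi>0 x))"


section \<open>Change of measure\<close>

definition hyp_H8 ::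
  "'e::topological_space set \<Rightarrow> ('e \<Rightarrow> (real \<Rightarrow> 'e) measure) \<Rightarrow> ('e \<Rightarrow> real) \<Rightarrow> bool" where
  "hyp_H8 E P \<phi>0 \<longleftrightarrow> \<phi>0 \<in> generator_domain E P \<and>
     (\<exists>C1 C2. 0 < C1 \<and> 0 < C2 \<and> (\<forall>x\<in>E. C1 \<le> \<phi>0 x \<and> \<phi>0 x \<le> C2))"

text \<open>The probability measures on path space specified by their densities on the filtration.\<close>

definition is_ground_transform ::
  "'e::topological_space set \<Rightarrow> ('e \<Rightarrow> (real \<Rightarrow> 'e) measure) \<Rightarrow> ('e \<Rightarrow> real) \<Rightarrow> real \<Rightarrow> ('e \<Rightarrow> real) \<Rightarrow>
   ('e \<Rightarrow> (real \<Rightarrow> 'e) measure) \<Rightarrow> bool" where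
  "is_ground_transform E P \<beta> l0 \<phi>0 P\<phi> \<longleftrightarrow>
     (\<forall>x\<in>E. prob_space (P\<phi> x) \<and> sets (P\<phi> x) = sets (path_filtration E \<infinity>) \<and>
        (\<forall>t\<ge>0. restr_to_subalg (P\<phi> x) (path_filtration E (ennreal t)) =
           density (restr_to_subalg (P x) (path_filtration E (ennreal t)))
             (\<lambda>\<omega>. ennreal (\<phi>0 (\<omega> t) / \<phi>0 (\<omega> 0) * exp (- path_integral (\<lambda>y. \<beta> y - l0) t \<omega>)))))"

definition hyp_H9 ::
  "'e::topological_space set \<Rightarrow> ('e \<Rightarrow> (real \<Rightarrow> 'e) measure) \<Rightarrow> 'e measure \<Rightarrow> bool" where
  "hyp_H9 E P\<phi> \<pi> \<longleftrightarrow>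
     prob_space \<pi> \<and> sets \<pi> = sets (restrict_space borel E) \<and>
     (\<forall>t\<ge>0. \<forall>A\<in>sets \<pi>.
        (\<integral>x. measure (P\<phi> x) {\<omega> \<in> cadlag_paths E. \<omega> t \<in> A} \<partial>\<pi>) = measure \<pi> A) \<and>
     (\<forall>x\<in>E. ((\<lambda>t. SUP f\<in>{f :: 'e \<Rightarrow> real. f \<in> borel_measurable (restrict_space borel E) \<and> (\<forall>y\<in>E. \<bar>f y\<bar> \<le> 1)}.
        \<bar>(\<integral>\<omega>. f (\<omega> t) \<partial>P\<phi> x) - (\<integral>y. f y \<partial>\<pi>)\<bar>) \<longlongrightarrow> 0) at_top)"

text \<open>A measure on the \<open>\<sigma>\<close>-algebra of time \<open>t\<close> only.\<close>

definition PB ::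
  "'e::topological_space set \<Rightarrow> ('e \<Rightarrow> (real \<Rightarrow> 'e) measure) \<Rightarrow> ('e \<Rightarrow> real) \<Rightarrow> 'e \<Rightarrow> real \<Rightarrow>
   (real \<Rightarrow> 'e) measure" where
  "PB E P \<beta> x t = density (restr_to_subalg (P x) (path_filtration E (ennreal t)))
     (\<lambda>\<omega>. ennreal (exp (- path_integral \<beta> t \<omega>) / (\<integral>\<eta>. exp (- path_integral \<beta> t \<eta>) \<partial>P x)))"


section \<open>Convergence of Radon--Nikodym derivatives\<close>

definition rn_on :: "'w measure \<Rightarrow> 'w measure \<Rightarrow> 'w measure \<Rightarrow> 'w \<Rightarrow> real" where
  "rn_on F M N \<omega> = enn2real (RN_deriv (restr_to_subalg M F) (restr_to_subalg N F) \<omega>)"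

definition rn_version_on :: "'w measure \<Rightarrow> 'w measure \<Rightarrow> 'w measure \<Rightarrow> ('w \<Rightarrow> real) \<Rightarrow> bool" where
  "rn_version_on F M N Z \<longleftrightarrow> Z \<in> borel_measurable F \<and> (\<forall>\<omega>\<in>space F. 0 \<le> Z \<omega>) \<and>
     density (restr_to_subalg M F) (\<lambda>\<omega>. ennreal (Z \<omega>)) = restr_to_subalg N F"

text \<open>Each Radon--Nikodym derivative is unique only up to a null set, and the parameter \<open>t\<close> is
  continuous. An almost sure limit as \<open>t \<rightarrow> \<infinity>\<close> hence makes sense only for a suitable family
  of versions; it implies almost sure convergence of arbitrary versions along every sequence
  \<open>t\<^sub>n \<rightarrow> \<infinity>\<close>. Convergence in \<open>L\<^sup>1\<close> does not depend on the versions.\<close>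

definition rn_converges_AE ::
  "'w measure \<Rightarrow> 'w measure \<Rightarrow> real \<Rightarrow> (real \<Rightarrow> 'w measure) \<Rightarrow> 'w measure \<Rightarrow> bool" where
  "rn_converges_AE F M t0 N N' \<longleftrightarrow>
     (\<exists>Z. (\<forall>t\<ge>t0. rn_version_on F M (N t) (Z t)) \<and>
          (AE \<omega> in M. ((\<lambda>t. Z t \<omega>) \<longlongrightarrow> rn_on F M N' \<omega>) at_top))"

definition rn_converges_L1 ::
  "'w measure \<Rightarrow> 'w measure \<Rightarrow> real \<Rightarrow> (real \<Rightarrow> 'w measure) \<Rightarrow> 'w measure \<Rightarrow> bool" where
  "rn_converges_L1 F M t0 N N' \<longleftrightarrow>
     (\<forall>t\<ge>t0. integrable M (rn_on F M (N t))) \<and> integrable M (rn_on F M N') \<and>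
     ((\<lambda>t. \<integral>\<omega>. \<bar>rn_on F M (N t) \<omega> - rn_on F M N' \<omega>\<bar> \<partial>M) \<longlongrightarrow> 0) at_top"

end

theory Submission
  imports Defs
begin

text \<open>By the Markov property at time \<open>t0\<close>, the density of the conditioned law on the past up to \<open>t0\<close> is
  \<open>exp (- I) * m (t - t0) (Y t0) / m t x\<close>, where \<open>I\<close> is the integral of \<open>\<beta>\<close> along the path up to
  \<open>t0\<close> and \<open>m s y\<close> is the Feynman--Kac mass \<open>E\<^sub>y[exp (- \<integral>\<^sub>0\<^sup>s \<beta>(Y))]\<close>. The ground state transform turns
  \<open>m s y\<close> into \<open>\<phi>0 y * exp (- l0 * s)\<close> times the mean of \<open>1 / \<phi>0 (Y s)\<close> under the transformed law,
  and (H9) makes this mean converge to a positive constant not depending on \<open>y\<close>, which cancels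
  in the quotient. The bounds on \<open>\<phi>0\<close> bound the densities uniformly, so dominated convergence
  gives the limit in \<open>L\<^sup>1\<close>.\<close>

section \<open>The canonical filtration\<close>

lemma space_raw_filtration [simp]: "space (raw_filtration E t) = cadlag_paths E"
  by (simp add: raw_filtration_def space_measure_of_conv)

lemma space_path_filtration [simp]: "space (path_filtration E t) = cadlag_paths E"
  by (simp add: path_filtration_def space_measure_of_conv)

lemma sets_raw_filtration_mono:
  assumes "s \<le> t"
  shows "sets (raw_filtration E s) \<subseteq> sets (raw_filtration E t)"
proof -
  have *: "sets (raw_filtration E t) = sigma_sets (cadlag_paths E)
     {{\<omega> \<in> cadlag_paths E. \<omega> r \<in> B} | r B. 0 \<le> r \<and> ennreal r \<le> t \<and> B \<in> sets borel}" for t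
    unfolding raw_filtration_def by (rule sets_measure_of) auto
  show ?thesis
    unfolding * using assms by (intro sigma_sets_mono') (auto intro: order_trans)
qed

lemma sets_path_filtration:
  "sets (path_filtration E t) = (\<Inter>s\<in>{s. t < s \<or> s = \<infinity>}. sets (raw_filtration E s))"
    (is "_ = ?I")
proof -
  have sub: "?I \<subseteq> Pow (cadlag_paths E)"
    using sets.space_closed[of "raw_filtration E \<infinity>"] by auto
  have "sets (path_filtration E t) = sigma_sets (cadlag_paths E) ?I"
    unfolding path_filtration_def using sub by (rule sets_measure_of)
  also have "\<dots> = ?I"
  proof
    show "sigma_sets (cadlag_paths E) ?I \<subseteq> ?I"
    proof (rule INT_greatest)
      fix s assume "s \<in> {s. t < s \<or> s = \<infinity>}"
      then have "?I \<subseteq> sets (raw_filtration E s)" by blast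
      from sets.sigma_sets_subset[OF this]
      show "sigma_sets (cadlag_paths E) ?I \<subseteq> sets (raw_filtration E s)" by simp
    qed
  qed auto
  finally show ?thesis .
qed

lemma sets_path_filtration_mono:
  assumes "s \<le> t"
  shows "sets (path_filtration E s) \<subseteq> sets (path_filtration E t)"
  unfolding sets_path_filtration using assms by (intro INF_superset_mono) auto

lemma sets_raw_subset_path_filtration: "sets (raw_filtration E t) \<subseteq> sets (path_filtration E t)"
  unfolding sets_path_filtration by (intro INT_greatest sets_raw_filtration_mono) auto

interpretation path: filtration "cadlag_paths E" "path_filtration E" for E
  by standard (auto intro: sets_path_filtration_mono[THEN subsetD])

text \<open>At time \<open>s\<close> the condition concerns \<open>A\<close> itself if
  \<open>t \<le> s\<close> and the empty set otherwise. This turns the strong Markov property at a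
  constant time into conditioning on \<open>path_filtration\<close>.\<close>

lemma sets_pre_sigma_const:
  "sets (filtration.pre_sigma (cadlag_paths E) (path_filtration E) (\<lambda>_. t)) = sets (path_filtration E t)"
proof -
  have "(\<forall>s. {\<omega> \<in> A. t \<le> s} \<in> sets (path_filtration E s)) \<longleftrightarrow> A \<in> sets (path_filtration E t)" for A
  proof
    assume "\<forall>s. {\<omega> \<in> A. t \<le> s} \<in> sets (path_filtration E s)"
    from this[rule_format, of t] show "A \<in> sets (path_filtration E t)" by simp
  next
    assume A: "A \<in> sets (path_filtration E t)"
    show "\<forall>s. {\<omega> \<in> A. t \<le> s} \<in> sets (path_filtration E s)"
    proof
      fix s
      show "{\<omega> \<in> A. t \<le> s} \<in> sets (path_filtration E s)"
        using sets_path_filtration_mono[of t s E] A by (cases "t \<le> s") auto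
    qed
  qed
  then show ?thesis
    unfolding path.sets_pre_sigma[OF stopping_time_const] by blast
qed

lemma measurable_raw_path:
  "f \<in> raw_filtration E t \<rightarrow>\<^sub>M N \<Longrightarrow> f \<in> path_filtration E t \<rightarrow>\<^sub>M N"
  using sets_raw_subset_path_filtration[of E t] by (auto simp: measurable_def)

lemma measurable_path_filtration_mono:
  "f \<in> path_filtration E s \<rightarrow>\<^sub>M N \<Longrightarrow> s \<le> t \<Longrightarrow> f \<in> path_filtration E t \<rightarrow>\<^sub>M N"
  using sets_path_filtration_mono[of s t E] by (auto simp: measurable_def)

lemma cadlag_paths_in: "\<omega> \<in> cadlag_paths E \<Longrightarrow> 0 \<le> t \<Longrightarrow> \<omega> t \<in> E"
  by (auto simp: cadlag_paths_def PiE_def Pi_def)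

lemma measurable_coordinate_raw:
  assumes "0 \<le> r" "ennreal r \<le> t"
  shows "(\<lambda>\<omega>. \<omega> r) \<in> raw_filtration E t \<rightarrow>\<^sub>M restrict_space borel E"
proof (rule measurable_restrict_space2)
  show "(\<lambda>\<omega>. \<omega> r) \<in> space (raw_filtration E t) \<rightarrow> E"
    using assms by (auto intro: cadlag_paths_in)
  show "(\<lambda>\<omega>. \<omega> r) \<in> raw_filtration E t \<rightarrow>\<^sub>M borel"
  proof (rule measurableI)
    fix B :: "'a set" assume B: "B \<in> sets borel"
    have eq: "(\<lambda>\<omega>. \<omega> r) -` B \<inter> space (raw_filtration E t) = {\<omega> \<in> cadlag_paths E. \<omega> r \<in> B}"
      by auto
    show "(\<lambda>\<omega>. \<omega> r) -` B \<inter> space (raw_filtration E t) \<in> sets (raw_filtration E t)"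
      unfolding eq unfolding raw_filtration_def
      by (rule in_measure_of) (use assms B in auto)
  qed simp
qed

lemma measurable_coordinate:
  assumes "0 \<le> r" "ennreal r \<le> t"
  shows "(\<lambda>\<omega>. \<omega> r) \<in> path_filtration E t \<rightarrow>\<^sub>M restrict_space borel E"
  using assms by (intro measurable_raw_path measurable_coordinate_raw)

section \<open>Integrals along paths\<close>

lemma Cb_measurable: "V \<in> Cb E \<Longrightarrow> V \<in> borel_measurable (restrict_space borel E)"
  by (auto simp: Cb_def intro: borel_measurable_continuous_on_restrict)

lemma Cb_bounded:
  assumes "V \<in> Cb E"
  obtains B where "0 < B" "\<And>y. y \<in> E \<Longrightarrow> \<bar>V y\<bar> \<le> B"
  using assms by (auto simp: Cb_def bounded_pos)

text \<open>Sampling the path on the grid \<open>\<int>/n\<close> strictly to the right of \<open>s\<close>, so that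
  right-continuity gives convergence as \<open>n \<rightarrow> \<infinity>\<close>.\<close>

definition grid_time :: "real \<Rightarrow> nat \<Rightarrow> int \<Rightarrow> real" where
  "grid_time t n k = max 0 (min t ((of_int k + 1) / real (Suc n)))"

text \<open>The sampling time exceeds \<open>s\<close> by at most \<open>1 / (n + 1)\<close>. For
  \<open>s < t\<close> the excess is strict, so the limit is one along \<open>at_right s\<close>; at
  \<open>s = t\<close> the cap at \<open>t\<close> makes the sequence constant.\<close>

lemma grid_time_tendsto:
  assumes s: "0 \<le> s" "s \<le> t" and V: "V \<in> Cb E" and \<omega>: "\<omega> \<in> cadlag_paths E"
  shows "(\<lambda>n. V (\<omega> (grid_time t n \<lfloor>s * real (Suc n)\<rfloor>))) \<longlonglongrightarrow> V (\<omega> s)"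
proof -
  define g where "g n = grid_time t n \<lfloor>s * real (Suc n)\<rfloor>" for n
  have gr: "s < (of_int \<lfloor>s * real (Suc n)\<rfloor> + 1) / real (Suc n)"
           "(of_int \<lfloor>s * real (Suc n)\<rfloor> + 1) / real (Suc n) \<le> s + 1 / real (Suc n)" for n
  proof -
    show "s < (of_int \<lfloor>s * real (Suc n)\<rfloor> + 1) / real (Suc n)"
      using real_of_int_floor_add_one_gt[of "s * real (Suc n)"]
      by (subst pos_less_divide_eq) auto
    have "(of_int \<lfloor>s * real (Suc n)\<rfloor> + 1) / real (Suc n) \<le> (s * real (Suc n) + 1) / real (Suc n)"
      by (intro divide_right_mono) auto
    also have "\<dots> = s + 1 / real (Suc n)" by (simp add: field_simps)
    finally show "(of_int \<lfloor>s * real (Suc n)\<rfloor> + 1) / real (Suc n) \<le> s + 1 / real (Suc n)" .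
  qed
  have g_ge: "s \<le> g n" and g_le: "g n \<le> s + 1 / real (Suc n)" and g_gt: "s < t \<Longrightarrow> s < g n" for n
    using gr[of n] s unfolding g_def grid_time_def by (auto simp del: of_nat_Suc)
  have lim: "g \<longlonglongrightarrow> s"
  proof (rule tendsto_sandwich[where f="\<lambda>_. s"])
    show "(\<lambda>n. s + 1 / real (Suc n)) \<longlonglongrightarrow> s"
      using tendsto_add[OF tendsto_const LIMSEQ_inverse_real_of_nat, of s]
      by (simp add: inverse_eq_divide)
  qed (use g_ge g_le in auto)
  show ?thesis
  proof (cases "s = t")
    case True
    then have "g n = s" for n
      using g_ge[of n] s unfolding g_def grid_time_def by (auto simp del: of_nat_Suc)
    then show ?thesis unfolding g_def by simp
  next
    case False
    then have "s < t" using s by simp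
    then have "filterlim g (at_right s) sequentially"
      using lim g_gt[OF \<open>s < t\<close>]
      by (auto simp: filterlim_at less_imp_neq[symmetric] intro!: always_eventually)
    moreover have "(\<omega> \<longlongrightarrow> \<omega> s) (at_right s)"
      using \<omega> s by (auto simp: cadlag_paths_def)
    ultimately have "(\<lambda>n. \<omega> (g n)) \<longlonglongrightarrow> \<omega> s"
      by (rule filterlim_compose[rotated])
    moreover have "g n \<ge> 0" for n using g_ge[of n] s by simp
    ultimately have "(\<lambda>n. V (\<omega> (g n))) \<longlonglongrightarrow> V (\<omega> s)"
      using V \<omega> s
      by (intro continuous_on_tendsto_compose[of E V]) (auto simp: Cb_def cadlag_paths_in)
    then show ?thesis unfolding g_def .
  qed
qed

text \<open>Progressive measurability: each approximation reads the path at countably many times,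
  all kept in \<open>[0, t]\<close> by the clamp in \<open>grid_time\<close>, so it is jointly
  measurable for the raw \<sigma>-algebra of time \<open>t\<close>. The pointwise limit inherits
  this.\<close>

lemma measurable_time_path:
  assumes t: "0 \<le> t" and V: "V \<in> Cb E"
  shows "(\<lambda>(\<omega>, s). indicator {0..t} s * V (\<omega> s)) \<in> borel_measurable (raw_filtration E (ennreal t) \<Otimes>\<^sub>M lborel)"
proof (rule borel_measurable_LIMSEQ_real)
  define u where "u n = (\<lambda>(\<omega>::real \<Rightarrow> 'a, s). indicator {0..t} s * V (\<omega> (grid_time t n \<lfloor>s * real (Suc n)\<rfloor>)))" for n
  show "(\<lambda>n. u n p) \<longlonglongrightarrow> (case p of (\<omega>, s) \<Rightarrow> indicator {0..t} s * V (\<omega> s))"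
    if "p \<in> space (raw_filtration E (ennreal t) \<Otimes>\<^sub>M lborel)" for p
    using that grid_time_tendsto[OF _ _ V, of "snd p" t "fst p"]
    by (auto simp: u_def space_pair_measure split: prod.splits intro!: tendsto_intros simp: indicator_def)
  show "u n \<in> borel_measurable (raw_filtration E (ennreal t) \<Otimes>\<^sub>M lborel)" for n
  proof -
    have "(\<lambda>\<omega>. V (\<omega> (grid_time t n k))) \<in> borel_measurable (raw_filtration E (ennreal t))" for k
      by (rule measurable_compose[OF measurable_coordinate_raw Cb_measurable[OF V]])
         (use t in \<open>auto simp: grid_time_def intro!: ennreal_leI simp del: of_nat_Suc\<close>)
    then have [measurable]: "(\<lambda>p. V ((fst p) (grid_time t n k))) \<in> borel_measurable (raw_filtration E (ennreal t) \<Otimes>\<^sub>M lborel)" for k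
      by (rule measurable_compose[OF measurable_fst])
    have "(\<lambda>p. V ((fst p) (grid_time t n \<lfloor>snd p * real (Suc n)\<rfloor>))) \<in> borel_measurable (raw_filtration E (ennreal t) \<Otimes>\<^sub>M lborel)"
      by (rule measurable_compose_countable[where f="\<lambda>k p. V ((fst p) (grid_time t n k))"]) measurable
    then show ?thesis unfolding u_def split_beta by measurable
  qed
qed

lemma integrable_indicator_Icc: "integrable lborel (indicator {0..t::real} :: real \<Rightarrow> real)"
  by (rule integrable_real_indicator) (auto simp: emeasure_lborel_Icc_eq)

lemma set_integrable_path:
  assumes t: "0 \<le> t" and V: "V \<in> Cb E" and \<omega>: "\<omega> \<in> cadlag_paths E"
  shows "set_integrable lborel {0..t} (\<lambda>s. V (\<omega> s))"
proof -
  obtain B where B: "\<And>y. y \<in> E \<Longrightarrow> \<bar>V y\<bar> \<le> B" using Cb_bounded[OF V] by blast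
  \<comment> \<open>Measurability in the time variable alone is that of a section of the jointly
    measurable map.\<close>
  have "(\<lambda>s. (\<omega>, s)) \<in> lborel \<rightarrow>\<^sub>M raw_filtration E (ennreal t) \<Otimes>\<^sub>M lborel"
    using \<omega> by (intro measurable_Pair1') simp
  from measurable_compose[OF this measurable_time_path[OF t V]]
  have m: "(\<lambda>s. indicator {0..t} s * V (\<omega> s)) \<in> borel_measurable lborel" by simp
  have b: "\<bar>indicator {0..t} s * V (\<omega> s)\<bar> \<le> \<bar>B * indicator {0..t} s\<bar>" for s
    using B[OF cadlag_paths_in[OF \<omega>, of s]] by (auto split: split_indicator)
  have i: "integrable lborel (\<lambda>s. B * indicator {0..t} s :: real)"
    by (rule integrable_mult_right) (rule integrable_indicator_Icc)
  show ?thesis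
    unfolding set_integrable_def real_scaleR_def
    by (rule Bochner_Integration.integrable_bound[OF i m]) (simp only: b real_norm_def eventually_True)
qed

lemma measurable_path_integral:
  assumes t: "0 \<le> t" and V: "V \<in> Cb E"
  shows "path_integral V t \<in> borel_measurable (path_filtration E (ennreal t))"
proof (rule measurable_raw_path)
  have "(\<lambda>\<omega>. LBINT s. indicator {0..t} s * V (\<omega> s)) \<in> borel_measurable (raw_filtration E (ennreal t))"
    by (rule lborel.borel_measurable_lebesgue_integral[OF measurable_time_path[OF t V]])
  then show "path_integral V t \<in> borel_measurable (raw_filtration E (ennreal t))"
    by (simp add: path_integral_def[abs_def] set_lebesgue_integral_def)
qed

lemma path_integral_bound:
  assumes t: "0 \<le> t" and V: "V \<in> Cb E" and \<omega>: "\<omega> \<in> cadlag_paths E"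
    and B: "\<And>y. y \<in> E \<Longrightarrow> \<bar>V y\<bar> \<le> B"
  shows "\<bar>path_integral V t \<omega>\<bar> \<le> B * t"
proof -
  have "\<bar>path_integral V t \<omega>\<bar> \<le> (LBINT s:{0..t}. B)"
    unfolding path_integral_def set_lebesgue_integral_def
  proof (rule Bochner_Integration.integral_abs_bound_integral)
    show "integrable lborel (\<lambda>s. indicator {0..t} s *\<^sub>R V (\<omega> s))"
      using set_integrable_path[OF t V \<omega>] by (simp only: set_integrable_def)
    show "integrable lborel (\<lambda>s. indicator {0..t} s *\<^sub>R B)"
      by (intro integrable_scaleR_left impI integrable_indicator_Icc)
    show "\<bar>indicator {0..t} s *\<^sub>R V (\<omega> s)\<bar> \<le> indicator {0..t} s *\<^sub>R B" for s
      using B[OF cadlag_paths_in[OF \<omega>, of s]] by (auto split: split_indicator)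
  qed
  also have "\<dots> = B * t" using t by (simp add: set_lebesgue_integral_def)
  finally show ?thesis .
qed

lemma path_integral_diff_const:
  assumes t: "0 \<le> t" and V: "V \<in> Cb E" and \<omega>: "\<omega> \<in> cadlag_paths E"
  shows "path_integral (\<lambda>y. V y - c) t \<omega> = path_integral V t \<omega> - c * t"
proof -
  have "path_integral (\<lambda>y. V y - c) t \<omega> = path_integral V t \<omega> - (LBINT s:{0..t}. c)"
    unfolding path_integral_def
    by (rule set_integral_diff(2)[OF set_integrable_path[OF t V \<omega>]]) (simp add: set_integrable_def integrable_indicator_Icc)
  also have "(LBINT s:{0..t}. c) = c * t" using t by (simp add: set_lebesgue_integral_def)
  finally show ?thesis .
qed

text \<open>Additive functional property: cut the interval at \<open>a\<close> and substitute
  \<open>a + s\<close> for the time in the second piece. It later separates the weight of the past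
  from that of the future.\<close>

lemma path_integral_shift:
  assumes a: "0 \<le> a" and b: "0 \<le> b" and V: "V \<in> Cb E" and \<omega>: "\<omega> \<in> cadlag_paths E"
  shows "path_integral V (a + b) \<omega> = path_integral V a \<omega> + path_integral V b (shift a \<omega>)"
proof -
  let ?f = "\<lambda>s. V (\<omega> s)"
  have int: "set_integrable lborel {0..a+b} ?f" using a b V \<omega> by (intro set_integrable_path) auto
  have i1: "set_integrable lborel {0..a} ?f" and i2: "set_integrable lborel {a..a+b} ?f"
    using a b by (auto intro: set_integrable_subset[OF int])
  have "path_integral V (a + b) \<omega> = (LBINT s:{0..a} \<union> {a..a+b}. ?f s)"
    unfolding path_integral_def by (rule arg_cong[where f="\<lambda>A. LBINT s:A. ?f s"]) (use a b in auto)
  also have "\<dots> = path_integral V a \<omega> + (LBINT s:{a..a+b}. ?f s)"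
    unfolding path_integral_def
  proof (rule set_integral_Un_AE)
    \<comment> \<open>The two pieces overlap only in the point \<open>a\<close>, a null set.\<close>
    show "AE x in lborel. \<not> (x \<in> {0..a} \<and> x \<in> {a..a+b})"
      using AE_lborel_singleton[of a] by eventually_elim auto
  qed (use i1 i2 in auto)
  also have "(LBINT s:{a..a+b}. ?f s) = (LBINT s. indicator {a..a+b} (a + 1 * s) * ?f (a + 1 * s))"
    unfolding set_lebesgue_integral_def by (subst lborel_integral_real_affine[where c=1 and t=a]) auto
  also have "\<dots> = path_integral V b (shift a \<omega>)"
    unfolding path_integral_def set_lebesgue_integral_def shift_def
    by (rule Bochner_Integration.integral_cong) (auto split: split_indicator)
  finally show ?thesis .
qed

text \<open>One constant serves all times and all paths, so at each fixed time the weight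
  \<open>exp (- path_integral V t \<omega>)\<close> is bounded above and bounded away from
  0.\<close>

lemma path_integral_le_linear:
  assumes V: "V \<in> Cb E"
  obtains B where
    "\<forall>t\<ge>0. \<forall>\<omega>\<in>cadlag_paths E. \<bar>path_integral V t \<omega>\<bar> \<le> B * t"
proof -
  obtain B where "0 < B" and B: "\<And>y. y \<in> E \<Longrightarrow> \<bar>V y\<bar> \<le> B" using Cb_bounded[OF V] by blast
  show thesis
    by (rule that[of B]) (intro allI impI ballI path_integral_bound[OF _ V _ B])
qed

lemma measurable_weight:
  assumes "V \<in> Cb E" "0 \<le> t"
  shows "(\<lambda>\<omega>. exp (- path_integral V t \<omega>)) \<in> borel_measurable (path_filtration E (ennreal t))"
  using measurable_path_integral[OF assms(2,1)] by measurable

lemma weight_shift: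
  assumes "V \<in> Cb E" "0 \<le> a" "0 \<le> b" "\<omega> \<in> cadlag_paths E"
  shows "exp (- path_integral V (a + b) \<omega>)
    = exp (- path_integral V a \<omega>) * exp (- path_integral V b (shift a \<omega>))"
  using path_integral_shift[OF assms(2,3,1,4)] by (simp add: exp_add[symmetric])

section \<open>Markov property and Feynman--Kac mass\<close>

lemma subalgebra_path_filtration:
  assumes "sets M = sets (path_filtration E \<infinity>)"
  shows "subalgebra M (path_filtration E t)"
  using sets_path_filtration_mono[of t \<infinity> E] sets_eq_imp_space_eq[OF assms] assms
  by (auto simp: subalgebra_def)

context
  fixes E :: "'e::topological_space set" and P :: "'e \<Rightarrow> (real \<Rightarrow> 'e) measure"
  assumes markov: "strong_markov E P"
begin

lemma markov_kernel: "P \<in> restrict_space borel E \<rightarrow>\<^sub>M prob_algebra (path_filtration E \<infinity>)"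
  using markov by (simp add: strong_markov_def)

lemma
  assumes "x \<in> E"
  shows markov_prob_space: "prob_space (P x)"
    and markov_sets: "sets (P x) = sets (path_filtration E \<infinity>)"
proof -
  have "P x \<in> space (prob_algebra (path_filtration E \<infinity>))"
    using markov_kernel assms by (auto intro: measurable_space simp: space_restrict_space)
  then show "prob_space (P x)" "sets (P x) = sets (path_filtration E \<infinity>)"
    by (auto simp: space_prob_algebra)
qed

lemma markov_space: "x \<in> E \<Longrightarrow> space (P x) = cadlag_paths E"
  using sets_eq_imp_space_eq[OF markov_sets] by simp

lemma markov_subalgebra: "x \<in> E \<Longrightarrow> subalgebra (P x) (path_filtration E t)"
  by (intro subalgebra_path_filtration markov_sets)

lemma markov_AE_initial: "x \<in> E \<Longrightarrow> AE \<omega> in P x. \<omega> 0 = x"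
  using markov by (simp add: strong_markov_def)

lemma markov_measurable:
  "x \<in> E \<Longrightarrow> f \<in> path_filtration E t \<rightarrow>\<^sub>M N \<Longrightarrow> f \<in> P x \<rightarrow>\<^sub>M N"
  by (rule measurable_from_subalg[OF markov_subalgebra])

text \<open>The strong Markov property at a deterministic time, which is always finite;
  \<open>0 \<le> a\<close> makes \<open>enn2real (ennreal a)\<close> equal to
  \<open>a\<close>.\<close>

lemma simple_markov:
  assumes "x \<in> E" "F \<in> borel_measurable (path_filtration E \<infinity>)" "bounded (F ` cadlag_paths E)" "0 \<le> a"
  shows "AE \<omega> in P x. real_cond_exp (P x)
      (filtration.pre_sigma (cadlag_paths E) (path_filtration E) (\<lambda>_. ennreal a))
      (\<lambda>\<omega>. F (shift a \<omega>)) \<omega> = (\<integral>\<eta>. F \<eta> \<partial>P (\<omega> a))"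
proof -
  have "AE \<omega> in P x. ennreal a < \<infinity> \<longrightarrow> real_cond_exp (P x)
      (filtration.pre_sigma (cadlag_paths E) (path_filtration E) (\<lambda>_. ennreal a))
      (\<lambda>\<omega>. F (shift (enn2real (ennreal a)) \<omega>)) \<omega> = (\<integral>\<eta>. F \<eta> \<partial>P (\<omega> (enn2real (ennreal a))))"
    using markov assms(1-3) stopping_time_const[of "path_filtration E" "ennreal a"]
    unfolding strong_markov_def by blast
  then show ?thesis using \<open>0 \<le> a\<close> by simp
qed

lemma integrable_markov_bounded:
  assumes "x \<in> E" "f \<in> borel_measurable (P x)" "\<And>\<omega>. \<omega> \<in> cadlag_paths E \<Longrightarrow> \<bar>f \<omega>\<bar> \<le> (B::real)"
  shows "integrable (P x) f"
proof -
  interpret prob_space "P x" by (rule markov_prob_space[OF assms(1)])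
  show ?thesis
    by (rule integrable_const_bound[where B=B]) (use assms markov_space in \<open>auto intro!: AE_I2\<close>)
qed

end

section \<open>The Feynman-Kac mass and the conditioned law on the past\<close>

text \<open>As a function of the starting point this is the Feynman-Kac semigroup of potential
  \<open>\<beta>\<close> applied to the constant 1; at \<open>x\<close> it is the normalising
  constant of \<open>PB\<close>.\<close>

definition fk_mass :: "('e \<Rightarrow> (real \<Rightarrow> 'e) measure) \<Rightarrow> ('e \<Rightarrow> real) \<Rightarrow> real \<Rightarrow> 'e \<Rightarrow> real" where
  "fk_mass P \<beta> t y = (\<integral>\<omega>. exp (- path_integral \<beta> t \<omega>) \<partial>P y)"

lemma fk_mass_nonneg: "0 \<le> fk_mass P \<beta> t y"
  unfolding fk_mass_def by (rule Bochner_Integration.integral_nonneg) auto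

context
  fixes E :: "'e::topological_space set" and P :: "'e \<Rightarrow> (real \<Rightarrow> 'e) measure" and \<beta> :: "'e \<Rightarrow> real"
  assumes markov: "strong_markov E P" and \<beta>: "\<beta> \<in> Cb E"
begin

lemma integrable_weight:
  assumes "x \<in> E" "0 \<le> t"
  shows "integrable (P x) (\<lambda>\<omega>. exp (- path_integral \<beta> t \<omega>))"
proof -
  obtain B where B: "\<forall>t\<ge>0. \<forall>\<omega>\<in>cadlag_paths E. \<bar>path_integral \<beta> t \<omega>\<bar> \<le> B * t"
    using path_integral_le_linear[OF \<beta>] by blast
  show ?thesis
    by (rule integrable_markov_bounded[where B="exp (B * t)", OF markov assms(1)
          markov_measurable[OF markov assms(1) measurable_weight[OF \<beta> assms(2)]]])
       (use B[rule_format, OF assms(2)] in \<open>simp add: abs_le_iff\<close>)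
qed

lemma fk_mass_pos:
  assumes "x \<in> E" "0 \<le> t"
  shows "0 < fk_mass P \<beta> t x"
proof -
  interpret prob_space "P x" by (rule markov_prob_space[OF markov assms(1)])
  obtain B where B: "\<forall>t\<ge>0. \<forall>\<omega>\<in>cadlag_paths E. \<bar>path_integral \<beta> t \<omega>\<bar> \<le> B * t"
    using path_integral_le_linear[OF \<beta>] by blast
  have "exp (- (B * t)) \<le> fk_mass P \<beta> t x"
    unfolding fk_mass_def
    by (rule integral_ge_const[OF integrable_weight[OF assms]])
       (use B[rule_format, OF assms(2)] markov_space[OF markov assms(1)] in \<open>auto intro!: AE_I2 simp: abs_le_iff\<close>)
  then show ?thesis using exp_gt_zero[of "- (B * t)"] by linarith
qed

text \<open>The laws depend measurably on the starting point, and integration of a fixed measurable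
  function is measurable in the measure. Needed because the mass is later evaluated at the random
  point \<open>\<omega> a\<close>.\<close>

lemma measurable_fk_mass:
  assumes "0 \<le> t"
  shows "fk_mass P \<beta> t \<in> borel_measurable (restrict_space borel E)"
proof -
  have w: "(\<lambda>\<omega>. exp (- path_integral \<beta> t \<omega>)) \<in> borel_measurable (path_filtration E \<infinity>)"
    by (rule measurable_path_filtration_mono[OF measurable_weight[OF \<beta> assms]]) simp
  show ?thesis
    unfolding fk_mass_def[abs_def]
    by (rule measurable_compose[OF measurable_prob_algebraD[OF markov_kernel[OF markov]]
          integral_measurable_subprob_algebra[OF w]])
qed

text \<open>The weight up to \<open>a + b\<close> is the weight up to \<open>a\<close> times the
  weight of the shifted path up to \<open>b\<close>. Conditioning on the past at time
  \<open>a\<close> leaves the first factor alone and replaces the second by its mean from the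
  current position.\<close>

lemma feynman_kac_markov:
  assumes x: "x \<in> E" and ab: "0 \<le> a" "0 \<le> b" and A: "A \<in> sets (path_filtration E (ennreal a))"
  shows "integrable (P x) (\<lambda>\<omega>. indicator A \<omega> * (exp (- path_integral \<beta> a \<omega>) * fk_mass P \<beta> b (\<omega> a)))"
    and "(\<integral>\<omega>. indicator A \<omega> * (exp (- path_integral \<beta> a \<omega>) * fk_mass P \<beta> b (\<omega> a)) \<partial>P x)
      = (\<integral>\<omega>. indicator A \<omega> * exp (- path_integral \<beta> (a + b) \<omega>) \<partial>P x)"
proof -
  interpret prob_space "P x" by (rule markov_prob_space[OF markov x])
  let ?G = "filtration.pre_sigma (cadlag_paths E) (path_filtration E) (\<lambda>_. ennreal a)"
  let ?I = "path_integral \<beta>"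
  let ?f = "\<lambda>\<omega>. indicator A \<omega> * exp (- ?I a \<omega>)"
  let ?F = "\<lambda>\<omega>. exp (- ?I b \<omega>)"
  let ?g = "\<lambda>\<omega>. ?F (shift a \<omega>)"
  have "subalgebra (P x) ?G"
    using markov_subalgebra[OF markov x, of "ennreal a"]
    unfolding subalgebra_def sets_pre_sigma_const path.space_pre_sigma by simp
  then interpret finite_measure_subalgebra "P x" ?G
    by unfold_locales
  have f: "?f \<in> borel_measurable (path_filtration E (ennreal a))"
    using measurable_weight[OF \<beta> ab(1)] A by measurable
  then have fG: "?f \<in> borel_measurable ?G"
    by (simp add: measurable_cong_sets[OF sets_pre_sigma_const refl])
  have [measurable]: "?I a \<in> borel_measurable (P x)" "?I (a + b) \<in> borel_measurable (P x)"
    using ab by (auto intro!: markov_measurable[OF markov x] measurable_path_integral \<beta>)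
  have [measurable]: "A \<in> sets (P x)"
    using A markov_subalgebra[OF markov x] by (auto simp: subalgebra_def)
  \<comment> \<open>Additivity rewrites the weight of the shifted path through the integrals up to
    \<open>a\<close> and \<open>a + b\<close>, so measurability of \<open>shift\<close> itself is
    not called upon.\<close>
  have g: "?g \<in> borel_measurable (P x)"
  proof (subst measurable_cong)
    fix \<omega> assume "\<omega> \<in> space (P x)"
    then show "?g \<omega> = exp (?I a \<omega> - ?I (a + b) \<omega>)"
      using path_integral_shift[OF ab \<beta>, of \<omega>] by (simp add: markov_space[OF markov x])
  qed measurable
  have eq: "?f \<omega> * ?g \<omega> = indicator A \<omega> * exp (- ?I (a + b) \<omega>)" if "\<omega> \<in> space (P x)" for \<omega>
    using that weight_shift[OF \<beta> ab] by (simp add: markov_space[OF markov x])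
  have "integrable (P x) (\<lambda>\<omega>. indicator A \<omega> * exp (- ?I (a + b) \<omega>))"
    using integrable_mult_indicator[OF \<open>A \<in> sets (P x)\<close> integrable_weight[OF x, of "a + b"]] ab by simp
  then have int: "integrable (P x) (\<lambda>\<omega>. ?f \<omega> * ?g \<omega>)"
    by (subst Bochner_Integration.integrable_cong[OF refl eq]) auto
  have Fm: "?F \<in> borel_measurable (path_filtration E \<infinity>)"
    by (rule measurable_path_filtration_mono[OF measurable_weight[OF \<beta> ab(2)]]) simp
  obtain B where B: "\<forall>t\<ge>0. \<forall>\<omega>\<in>cadlag_paths E. \<bar>?I t \<omega>\<bar> \<le> B * t"
    using path_integral_le_linear[OF \<beta>] by blast
  have Fb: "bounded (?F ` cadlag_paths E)"
    unfolding bounded_iff real_norm_def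
    using B[rule_format, OF ab(2)] by (intro exI[of _ "exp (B * b)"]) (force dest: abs_le_D2)
  have "AE \<omega> in P x. real_cond_exp (P x) ?G ?g \<omega> = fk_mass P \<beta> b (\<omega> a)"
    unfolding fk_mass_def by (rule simple_markov[OF markov x Fm Fb ab(1)])
  then have AE: "AE \<omega> in P x. ?f \<omega> * real_cond_exp (P x) ?G ?g \<omega>
      = indicator A \<omega> * (exp (- ?I a \<omega>) * fk_mass P \<beta> b (\<omega> a))"
    by eventually_elim simp
  have m: "(\<lambda>\<omega>. indicator A \<omega> * (exp (- ?I a \<omega>) * fk_mass P \<beta> b (\<omega> a))) \<in> borel_measurable (P x)"
    using markov_measurable[OF markov x measurable_compose[OF measurable_coordinate[OF ab(1) order_refl]
      measurable_fk_mass[OF ab(2)]]] by measurable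
  have m': "(\<lambda>\<omega>. ?f \<omega> * real_cond_exp (P x) ?G ?g \<omega>) \<in> borel_measurable (P x)"
    using real_cond_exp_intg(1)[OF int fG g] by (rule borel_measurable_integrable)
  \<comment> \<open>\<open>?f\<close> is measurable with respect to the past, so integrating it
    against the conditional expectation of \<open>?g\<close> is the same as integrating
    \<open>?f * ?g\<close>.\<close>
  show "integrable (P x) (\<lambda>\<omega>. indicator A \<omega> * (exp (- ?I a \<omega>) * fk_mass P \<beta> b (\<omega> a)))"
    using real_cond_exp_intg(1)[OF int fG g] integrable_cong_AE[OF m' m AE] by simp
  show "(\<integral>\<omega>. indicator A \<omega> * (exp (- ?I a \<omega>) * fk_mass P \<beta> b (\<omega> a)) \<partial>P x)
      = (\<integral>\<omega>. indicator A \<omega> * exp (- ?I (a + b) \<omega>) \<partial>P x)"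
    using real_cond_exp_intg(2)[OF int fG g] integral_cong_AE[OF m' m AE]
      Bochner_Integration.integral_cong[OF refl eq, of "P x"] by simp
qed

text \<open>Projecting the density at time \<open>a + b\<close> onto the past of \<open>a\<close> is
  taking its conditional expectation. Both measures are compared on each event \<open>A\<close> of
  the past, where they agree by \<open>feynman_kac_markov\<close>.\<close>

lemma rn_version_PB:
  assumes x: "x \<in> E" and ab: "0 \<le> a" "0 \<le> b"
  shows "rn_version_on (path_filtration E (ennreal a)) (P x) (PB E P \<beta> x (a + b))
    (\<lambda>\<omega>. exp (- path_integral \<beta> a \<omega>) * fk_mass P \<beta> b (\<omega> a) / fk_mass P \<beta> (a + b) x)"
    (is "rn_version_on ?Fa _ _ ?Z")
proof -
  let ?I = "path_integral \<beta>" and ?Fab = "path_filtration E (ennreal (a + b))"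
  define c where "c = fk_mass P \<beta> (a + b) x"
  have c: "0 < c" unfolding c_def using x ab by (intro fk_mass_pos) auto
  have Z: "?Z \<in> borel_measurable ?Fa"
    using measurable_weight[OF \<beta> ab(1)]
      measurable_compose[OF measurable_coordinate[OF ab(1) order_refl] measurable_fk_mass[OF ab(2)]]
    by measurable
  have Z0: "0 \<le> ?Z \<omega>" for \<omega> by (simp add: fk_mass_nonneg)
  have sub: "subalgebra (P x) ?Fa" "subalgebra (P x) ?Fab" by (intro markov_subalgebra[OF markov x])+
  have PB: "PB E P \<beta> x (a + b) = density (restr_to_subalg (P x) ?Fab) (\<lambda>\<omega>. ennreal (exp (- ?I (a + b) \<omega>) / c))"
    by (simp add: PB_def c_def fk_mass_def)
  have le: "sets ?Fa \<subseteq> sets ?Fab" using ab by (intro sets_path_filtration_mono ennreal_leI) auto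
  \<comment> \<open>\<open>PB\<close> lives only on the \<sigma>-algebra of its own time, so
    restricting it to time \<open>a\<close> relies on the inclusion just shown.\<close>
  have subPB: "subalgebra (PB E P \<beta> x (a + b)) ?Fa"
    using le by (auto simp: subalgebra_def PB sets_restr_to_subalg[OF sub(2)] space_restr_to_subalg markov_space[OF markov x])
  have wm: "(\<lambda>\<omega>. ennreal (exp (- ?I (a + b) \<omega>) / c)) \<in> borel_measurable ?Fab"
    using ab by (intro measurable_compose[OF _ measurable_ennreal] borel_measurable_divide measurable_weight \<beta>) auto
  have "density (restr_to_subalg (P x) ?Fa) (\<lambda>\<omega>. ennreal (?Z \<omega>)) = restr_to_subalg (PB E P \<beta> x (a + b)) ?Fa"
  proof (rule measure_eqI)
    fix A assume "A \<in> sets (density (restr_to_subalg (P x) ?Fa) (\<lambda>\<omega>. ennreal (?Z \<omega>)))"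
    then have A: "A \<in> sets ?Fa" by (simp add: sets_restr_to_subalg[OF sub(1)])
    then have A': "A \<in> sets ?Fab" using le by auto
    then have AP: "A \<in> sets (P x)" using sub(2) by (auto simp: subalgebra_def)
    have int: "integrable (P x) (\<lambda>\<omega>. indicator A \<omega> * exp (- ?I (a + b) \<omega>))"
      using integrable_mult_indicator[OF AP integrable_weight[OF x, of "a + b"]] ab by simp
    have "emeasure (density (restr_to_subalg (P x) ?Fa) (\<lambda>\<omega>. ennreal (?Z \<omega>))) A
        = (\<integral>\<^sup>+\<omega>. ennreal (?Z \<omega>) * indicator A \<omega> \<partial>restr_to_subalg (P x) ?Fa)"
      using Z A sub(1) by (intro emeasure_density measurable_in_subalg measurable_compose[OF Z measurable_ennreal])
        (auto simp: sets_restr_to_subalg)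
    also have "\<dots> = (\<integral>\<^sup>+\<omega>. ennreal (?Z \<omega>) * indicator A \<omega> \<partial>P x)"
      using A by (intro nn_integral_subalgebra2[OF sub(1)] borel_measurable_times_ennreal
        measurable_compose[OF Z measurable_ennreal] borel_measurable_indicator)
    also have "\<dots> = (\<integral>\<^sup>+\<omega>. ennreal (indicator A \<omega> * (exp (- ?I a \<omega>) * fk_mass P \<beta> b (\<omega> a)) / c) \<partial>P x)"
      by (intro nn_integral_cong) (simp add: c_def split: split_indicator)
    also have "\<dots> = ennreal (\<integral>\<omega>. indicator A \<omega> * (exp (- ?I a \<omega>) * fk_mass P \<beta> b (\<omega> a)) / c \<partial>P x)"
      using feynman_kac_markov(1)[OF x ab A] c
      by (intro nn_integral_eq_integral AE_I2 integrable_divide divide_nonneg_nonneg mult_nonneg_nonneg fk_mass_nonneg) auto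
    also have "\<dots> = ennreal (\<integral>\<omega>. indicator A \<omega> * exp (- ?I (a + b) \<omega>) / c \<partial>P x)"
      using feynman_kac_markov(2)[OF x ab A] by simp
    also have "\<dots> = (\<integral>\<^sup>+\<omega>. ennreal (indicator A \<omega> * exp (- ?I (a + b) \<omega>) / c) \<partial>P x)"
      using int c by (intro nn_integral_eq_integral[symmetric] AE_I2 integrable_divide divide_nonneg_nonneg mult_nonneg_nonneg) auto
    also have "\<dots> = (\<integral>\<^sup>+\<omega>. ennreal (exp (- ?I (a + b) \<omega>) / c) * indicator A \<omega> \<partial>P x)"
      by (intro nn_integral_cong) (simp split: split_indicator)
    also have "\<dots> = (\<integral>\<^sup>+\<omega>. ennreal (exp (- ?I (a + b) \<omega>) / c) * indicator A \<omega> \<partial>restr_to_subalg (P x) ?Fab)"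
      using A' by (intro nn_integral_subalgebra2[OF sub(2), symmetric] borel_measurable_times_ennreal wm
        borel_measurable_indicator)
    also have "\<dots> = emeasure (PB E P \<beta> x (a + b)) A"
      unfolding PB using wm A' sub(2)
      by (intro emeasure_density[symmetric] measurable_in_subalg) (auto simp: sets_restr_to_subalg)
    also have "\<dots> = emeasure (restr_to_subalg (PB E P \<beta> x (a + b)) ?Fa) A"
      by (rule emeasure_restr_to_subalg[OF subPB A, symmetric])
    finally show "emeasure (density (restr_to_subalg (P x) ?Fa) (\<lambda>\<omega>. ennreal (?Z \<omega>))) A
        = emeasure (restr_to_subalg (PB E P \<beta> x (a + b)) ?Fa) A" .
  qed (simp add: sets_restr_to_subalg sub subPB)
  then show ?thesis unfolding rn_version_on_def using Z Z0 by auto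
qed

end

section \<open>Versions of Radon-Nikodym derivatives\<close>

text \<open>Uniqueness of the derivative holds almost everywhere for the restricted measure and
  carries over to \<open>M\<close>; since \<open>Z\<close> is nonnegative, \<open>enn2real\<close>
  recovers it from \<open>ennreal (Z \<omega>)\<close>.\<close>

lemma (in prob_space) rn_on_eq_version:
  assumes sub: "subalgebra M F" and Z: "rn_version_on F M N Z"
  shows "AE \<omega> in M. rn_on F M N \<omega> = Z \<omega>"
proof -
  let ?M = "restr_to_subalg M F"
  interpret R: prob_space ?M by (rule prob_space_restr_to_subalg[OF sub prob_space_axioms])
  have "(\<lambda>\<omega>. ennreal (Z \<omega>)) \<in> borel_measurable ?M"
    using Z sub by (auto simp: rn_version_on_def intro!: measurable_in_subalg)
  from R.RN_deriv_unique[OF this] Z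
  have "AE \<omega> in ?M. ennreal (Z \<omega>) = RN_deriv ?M (restr_to_subalg N F) \<omega>"
    by (auto simp: rn_version_on_def)
  from AE_restr_to_subalg[OF sub this] AE_space show ?thesis
  proof eventually_elim
    case (elim \<omega>)
    then have "0 \<le> Z \<omega>" using Z sub by (auto simp: rn_version_on_def subalgebra_def)
    with elim show ?case by (simp add: rn_on_def flip: elim(1))
  qed
qed

lemma (in prob_space) measurable_rn_on:
  assumes sub: "subalgebra M F"
  shows "rn_on F M N \<in> borel_measurable M"
proof -
  have "rn_on F M N \<in> borel_measurable (restr_to_subalg M F)"
    unfolding rn_on_def[abs_def] by measurable
  then show ?thesis using measurable_from_subalg[OF sub measurable_in_subalg'[OF sub]] by blast
qed

text \<open>No integrability is assumed: a non-integrable function has integral 0, which is within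
  the bound as \<open>0 \<le> B\<close>.\<close>

lemma (in prob_space) abs_integral_le_bound:
  fixes f :: "'a \<Rightarrow> real"
  assumes "\<And>x. x \<in> space M \<Longrightarrow> \<bar>f x\<bar> \<le> B" "0 \<le> B"
  shows "\<bar>integral\<^sup>L M f\<bar> \<le> B"
proof (cases "integrable M f")
  case True
  have "\<bar>integral\<^sup>L M f\<bar> \<le> (\<integral>x. \<bar>f x\<bar> \<partial>M)" by (rule integral_abs_bound)
  also have "\<dots> \<le> B"
    using True assms(1) by (intro integral_le_const integrable_abs AE_I2) auto
  finally show ?thesis .
qed (use assms(2) in \<open>simp add: not_integrable_integral_eq\<close>)

section \<open>Ground state transform\<close>

text \<open>Common setting for the chain and the diffusion. The bounds of (H8) are named so that the
  later estimates can be written with explicit constants.\<close>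

locale ground_state_process =
  fixes E :: "'e::topological_space set" and P :: "'e \<Rightarrow> (real \<Rightarrow> 'e) measure"
    and \<beta> :: "'e \<Rightarrow> real" and l0 :: real and \<phi>0 :: "'e \<Rightarrow> real"
    and P\<phi> :: "'e \<Rightarrow> (real \<Rightarrow> 'e) measure" and \<pi> :: "'e measure" and C1 C2 :: real
  assumes markov: "strong_markov E P" and \<beta>: "\<beta> \<in> Cb E" and \<phi>0: "\<phi>0 \<in> Cb E"
    and C1_pos: "0 < C1" and C1_le: "\<And>y. y \<in> E \<Longrightarrow> C1 \<le> \<phi>0 y" and le_C2: "\<And>y. y \<in> E \<Longrightarrow> \<phi>0 y \<le> C2"
    and transform: "is_ground_transform E P \<beta> l0 \<phi>0 P\<phi>"
    and ergodic: "hyp_H9 E P\<phi> \<pi>"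
begin

definition inv_mean :: "real \<Rightarrow> 'e \<Rightarrow> real" where
  "inv_mean t y = (\<integral>\<omega>. 1 / \<phi>0 (\<omega> t) \<partial>P\<phi> y)"

definition ground_density :: "real \<Rightarrow> (real \<Rightarrow> 'e) \<Rightarrow> real" where
  "ground_density t \<omega> = \<phi>0 (\<omega> t) / \<phi>0 (\<omega> 0) * exp (- path_integral (\<lambda>y. \<beta> y - l0) t \<omega>)"

lemma \<phi>0_pos: "y \<in> E \<Longrightarrow> 0 < \<phi>0 y"
  using C1_pos C1_le[of y] by simp

lemma C2_pos: "y \<in> E \<Longrightarrow> 0 < C2"
  using \<phi>0_pos[of y] le_C2[of y] by simp

lemma inverse_\<phi>0_bounds:
  assumes "y \<in> E"
  shows "1 / C2 \<le> 1 / \<phi>0 y" "1 / \<phi>0 y \<le> 1 / C1"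
  using \<phi>0_pos[OF assms] C1_pos C1_le[OF assms] le_C2[OF assms] by (auto intro!: divide_left_mono)

lemma measurable_inverse_\<phi>0: "(\<lambda>y. 1 / \<phi>0 y) \<in> borel_measurable (restrict_space borel E)"
  using Cb_measurable[OF \<phi>0] by measurable

lemma
  assumes "y \<in> E"
  shows transform_prob_space: "prob_space (P\<phi> y)"
    and transform_sets: "sets (P\<phi> y) = sets (path_filtration E \<infinity>)"
    and transform_density: "0 \<le> t \<Longrightarrow> restr_to_subalg (P\<phi> y) (path_filtration E (ennreal t)) =
      density (restr_to_subalg (P y) (path_filtration E (ennreal t))) (\<lambda>\<omega>. ennreal (ground_density t \<omega>))"
  using transform assms by (auto simp: is_ground_transform_def ground_density_def)

lemma transform_space: "y \<in> E \<Longrightarrow> space (P\<phi> y) = cadlag_paths E"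
  using sets_eq_imp_space_eq[OF transform_sets] by simp

lemma measurable_\<phi>0_coordinate:
  "0 \<le> s \<Longrightarrow> s \<le> t \<Longrightarrow> (\<lambda>\<omega>. \<phi>0 (\<omega> s)) \<in> borel_measurable (path_filtration E (ennreal t))"
  by (intro measurable_compose[OF measurable_coordinate Cb_measurable[OF \<phi>0]] ennreal_leI)

lemma ground_density_eq:
  assumes "0 \<le> t" "\<omega> \<in> cadlag_paths E"
  shows "ground_density t \<omega> = \<phi>0 (\<omega> t) / \<phi>0 (\<omega> 0) * (exp (l0 * t) * exp (- path_integral \<beta> t \<omega>))"
  using path_integral_diff_const[OF assms(1) \<beta> assms(2), of l0]
  by (simp add: ground_density_def exp_add[symmetric])

lemma measurable_ground_density:
  assumes "0 \<le> t"
  shows "ground_density t \<in> borel_measurable (path_filtration E (ennreal t))"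
proof -
  have "(\<lambda>\<omega>. \<phi>0 (\<omega> t) / \<phi>0 (\<omega> 0) * (exp (l0 * t) * exp (- path_integral \<beta> t \<omega>)))
      \<in> borel_measurable (path_filtration E (ennreal t))"
    using assms by (intro borel_measurable_times borel_measurable_divide measurable_\<phi>0_coordinate
      measurable_weight[OF \<beta>] borel_measurable_const) auto
  then show ?thesis
    by (subst measurable_cong[OF ground_density_eq[OF assms]]) auto
qed

lemma ground_density_nonneg:
  assumes "0 \<le> t" "\<omega> \<in> cadlag_paths E"
  shows "0 \<le> ground_density t \<omega>"
  using \<phi>0_pos[OF cadlag_paths_in[OF assms(2), of t]] \<phi>0_pos[OF cadlag_paths_in[OF assms(2), of 0]] assms(1)
  by (simp add: ground_density_def)

lemma rn_version_ground:
  assumes "x \<in> E" "0 \<le> t"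
  shows "rn_version_on (path_filtration E (ennreal t)) (P x) (P\<phi> x) (ground_density t)"
  unfolding rn_version_on_def
  using assms by (auto simp: transform_density measurable_ground_density ground_density_nonneg)

section \<open>The mean of the reciprocal ground state and its ergodic limit\<close>

text \<open>The bounds are uniform in the time and the starting point, which is what makes a
  dominating constant independent of \<open>t\<close> possible.\<close>

lemma inv_mean_bounds:
  assumes "y \<in> E" "0 \<le> t"
  shows "1 / C2 \<le> inv_mean t y" "inv_mean t y \<le> 1 / C1"
proof -
  interpret prob_space "P\<phi> y" by (rule transform_prob_space[OF assms(1)])
  have "(\<lambda>\<omega>. 1 / \<phi>0 (\<omega> t)) \<in> borel_measurable (P\<phi> y)"
    using measurable_compose[OF measurable_coordinate[OF assms(2) order_refl] measurable_inverse_\<phi>0]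
    by (rule measurable_from_subalg[OF subalgebra_path_filtration[OF transform_sets[OF assms(1)]]])
  moreover have b: "1 / C2 \<le> 1 / \<phi>0 (\<omega> t)" "1 / \<phi>0 (\<omega> t) \<le> 1 / C1" if "\<omega> \<in> space (P\<phi> y)" for \<omega>
    using that assms inverse_\<phi>0_bounds[of "\<omega> t"] by (auto simp: transform_space intro: cadlag_paths_in)
  moreover have "norm (1 / \<phi>0 (\<omega> t)) \<le> 1 / C1" if "\<omega> \<in> space (P\<phi> y)" for \<omega>
    using b[OF that] C2_pos[OF assms(1)] divide_pos_pos[OF zero_less_one, of C2]
    unfolding real_norm_def abs_le_iff by linarith
  ultimately have "integrable (P\<phi> y) (\<lambda>\<omega>. 1 / \<phi>0 (\<omega> t))"
    by (intro integrable_const_bound[where B="1 / C1"] AE_I2)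
  then show "1 / C2 \<le> inv_mean t y" "inv_mean t y \<le> 1 / C1"
    unfolding inv_mean_def using b by (auto intro!: integral_ge_const integral_le_const AE_I2)
qed

text \<open>The test function \<open>1 / \<phi>0 (\<omega> t)\<close> cancels the terminal factor of
  the transformed density, leaving the Feynman-Kac weight up to \<open>exp (l0 * t)\<close> and the
  initial factor, which is \<open>1 / \<phi>0 y\<close> almost surely because \<open>P y\<close>
  starts at \<open>y\<close>.\<close>

lemma fk_mass_eq_inv_mean:
  assumes y: "y \<in> E" and t: "0 \<le> t"
  shows "fk_mass P \<beta> t y = \<phi>0 y * exp (- l0 * t) * inv_mean t y"
proof -
  let ?F = "path_filtration E (ennreal t)"
  let ?g = "\<lambda>\<omega>. 1 / \<phi>0 (\<omega> t)"
  have sub: "subalgebra (P y) ?F" "subalgebra (P\<phi> y) ?F"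
    by (rule markov_subalgebra[OF markov y]) (rule subalgebra_path_filtration[OF transform_sets[OF y]])
  have g: "?g \<in> borel_measurable ?F"
    by (rule measurable_compose[OF measurable_coordinate[OF t order_refl] measurable_inverse_\<phi>0])
  have D: "ground_density t \<in> borel_measurable ?F" by (rule measurable_ground_density[OF t])
  have "inv_mean t y = (\<integral>\<omega>. ?g \<omega> \<partial>restr_to_subalg (P\<phi> y) ?F)"
    unfolding inv_mean_def by (rule integral_subalgebra2[OF sub(2) g, symmetric])
  also have "\<dots> = (\<integral>\<omega>. ground_density t \<omega> *\<^sub>R ?g \<omega> \<partial>restr_to_subalg (P y) ?F)"
    unfolding transform_density[OF y t]
  proof (rule integral_density)
    show "AE \<omega> in restr_to_subalg (P y) ?F. 0 \<le> ground_density t \<omega>"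
      using ground_density_nonneg[OF t]
      by (intro AE_I2) (simp add: space_restr_to_subalg markov_space[OF markov y])
  qed (use g D sub(1) in \<open>auto intro: measurable_in_subalg\<close>)
  also have "\<dots> = (\<integral>\<omega>. ground_density t \<omega> * ?g \<omega> \<partial>P y)"
    unfolding real_scaleR_def using g D by (intro integral_subalgebra2[OF sub(1)] borel_measurable_times)
  also have "\<dots> = (\<integral>\<omega>. exp (l0 * t) / \<phi>0 y * exp (- path_integral \<beta> t \<omega>) \<partial>P y)"
  proof (rule integral_cong_AE)
    show "AE \<omega> in P y. ground_density t \<omega> * ?g \<omega> = exp (l0 * t) / \<phi>0 y * exp (- path_integral \<beta> t \<omega>)"
      using markov_AE_initial[OF markov y] AE_space
    proof eventually_elim
      case (elim \<omega>)
      then have \<omega>: "\<omega> \<in> cadlag_paths E" by (simp add: markov_space[OF markov y])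
      show ?case
        using \<phi>0_pos[OF cadlag_paths_in[OF \<omega> t]] elim(1) by (simp add: ground_density_eq[OF t \<omega>])
    qed
    show "(\<lambda>\<omega>. ground_density t \<omega> * ?g \<omega>) \<in> borel_measurable (P y)"
      by (rule markov_measurable[OF markov y borel_measurable_times[OF D g]])
    show "(\<lambda>\<omega>. exp (l0 * t) / \<phi>0 y * exp (- path_integral \<beta> t \<omega>)) \<in> borel_measurable (P y)"
      by (rule markov_measurable[OF markov y borel_measurable_times[OF borel_measurable_const
            measurable_weight[OF \<beta> t]]])
  qed
  also have "\<dots> = exp (l0 * t) / \<phi>0 y * fk_mass P \<beta> t y"
    unfolding fk_mass_def by (rule integral_mult_right_zero)
  finally show ?thesis
    using \<phi>0_pos[OF y] by (simp add: exp_minus field_simps)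
qed

lemma
  shows stationary_prob_space: "prob_space \<pi>" and stationary_sets: "sets \<pi> = sets (restrict_space borel E)"
  using ergodic by (auto simp: hyp_H9_def)

lemma stationary_space: "space \<pi> = E"
  using sets_eq_imp_space_eq[OF stationary_sets] by (simp add: space_restrict_space)

lemma inv_mean_tendsto:
  assumes y: "y \<in> E"
  shows "((\<lambda>t. inv_mean t y) \<longlongrightarrow> (\<integral>z. 1 / \<phi>0 z \<partial>\<pi>)) at_top"
proof -
  interpret Q: prob_space "P\<phi> y" by (rule transform_prob_space[OF y])
  interpret pi: prob_space \<pi> by (rule stationary_prob_space)
  let ?S = "{f :: 'e \<Rightarrow> real. f \<in> borel_measurable (restrict_space borel E) \<and> (\<forall>y\<in>E. \<bar>f y\<bar> \<le> 1)}"
  let ?d = "\<lambda>t f. \<bar>(\<integral>\<omega>. f (\<omega> t) \<partial>P\<phi> y) - (\<integral>z. f z \<partial>\<pi>)\<bar>"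
  have lim: "((\<lambda>t. SUP f\<in>?S. ?d t f) \<longlongrightarrow> 0) at_top"
    using ergodic y by (simp add: hyp_H9_def)
  \<comment> \<open>(H9) controls functions bounded by 1; since \<open>C1 \<le> \<phi>0\<close>,
    scaling the reciprocal by \<open>C1\<close> brings it into that class. The scaling is undone at
    the end.\<close>
  define f where "f z = C1 * (1 / \<phi>0 z)" for z
  have fS: "f \<in> ?S"
    unfolding f_def
  proof (intro CollectI conjI ballI)
    show "(\<lambda>z. C1 * (1 / \<phi>0 z)) \<in> borel_measurable (restrict_space borel E)"
      by (intro borel_measurable_times borel_measurable_const measurable_inverse_\<phi>0)
    show "\<bar>C1 * (1 / \<phi>0 z)\<bar> \<le> 1" if "z \<in> E" for z
      using C1_pos C1_le[OF that] \<phi>0_pos[OF that] by simp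
  qed
  have le: "?d t f \<le> (SUP f\<in>?S. ?d t f)" if t: "0 \<le> t" for t
  proof (rule cSUP_upper[OF fS])
    \<comment> \<open>A real supremum dominates its members only when the family is bounded above;
      here both integrals have modulus at most 1, whence the bound 2.\<close>
    show "bdd_above ((?d t) ` ?S)"
    proof (rule bdd_aboveI2)
      fix h assume h: "h \<in> ?S"
      have "\<bar>\<integral>\<omega>. h (\<omega> t) \<partial>P\<phi> y\<bar> \<le> 1"
        using h t y by (intro Q.abs_integral_le_bound) (auto simp: transform_space cadlag_paths_in)
      moreover have "\<bar>\<integral>z. h z \<partial>\<pi>\<bar> \<le> 1"
        using h by (intro pi.abs_integral_le_bound) (auto simp: stationary_space)
      ultimately show "?d t h \<le> 2" by linarith
    qed
  qed
  have "((\<lambda>t. (\<integral>\<omega>. f (\<omega> t) \<partial>P\<phi> y) - (\<integral>z. f z \<partial>\<pi>)) \<longlongrightarrow> 0) at_top"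
    by (intro Lim_null_comparison[OF _ lim] eventually_mono[OF eventually_ge_at_top[of 0]])
       (simp only: real_norm_def le)
  then have "((\<lambda>t. C1 * inv_mean t y - C1 * (\<integral>z. 1 / \<phi>0 z \<partial>\<pi>)) \<longlongrightarrow> 0) at_top"
    unfolding f_def inv_mean_def integral_mult_right_zero .
  from tendsto_mult[OF tendsto_const this, of "1 / C1"]
  have "((\<lambda>t. inv_mean t y - (\<integral>z. 1 / \<phi>0 z \<partial>\<pi>)) \<longlongrightarrow> 0) at_top"
    using C1_pos by (simp add: right_diff_distrib)
  then show ?thesis by (subst (asm) LIM_zero_iff)
qed

text \<open>The limit constant appears in numerator and denominator, and its positivity permits the
  cancellation.\<close>

lemma stationary_inverse_pos: "0 < (\<integral>z. 1 / \<phi>0 z \<partial>\<pi>)"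
proof -
  interpret pi: prob_space \<pi> by (rule stationary_prob_space)
  \<comment> \<open>A probability measure lives on a nonempty space, and a point of \<open>E\<close>
    is what yields \<open>0 < C2\<close>.\<close>
  obtain y where y: "y \<in> E" using pi.not_empty by (auto simp: stationary_space)
  have "(\<lambda>z. 1 / \<phi>0 z) \<in> borel_measurable \<pi>"
    using measurable_inverse_\<phi>0 by (simp add: measurable_cong_sets[OF stationary_sets refl])
  then have "integrable \<pi> (\<lambda>z. 1 / \<phi>0 z)"
    using inverse_\<phi>0_bounds \<phi>0_pos
    by (intro pi.integrable_const_bound[where B="1 / C1"] AE_I2) (auto simp: stationary_space abs_if less_le_not_le)
  then have "1 / C2 \<le> (\<integral>z. 1 / \<phi>0 z \<partial>\<pi>)"
    by (rule pi.integral_ge_const) (use inverse_\<phi>0_bounds in \<open>auto intro!: AE_I2 simp: stationary_space\<close>)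
  moreover have "0 < 1 / C2" using C2_pos[OF y] by simp
  ultimately show ?thesis by linarith
qed

section \<open>Explicit density of the conditioned law, its limit and its bound\<close>

text \<open>An explicit version for each \<open>t \<ge> a\<close>, so that a pointwise limit along
  continuous \<open>t\<close> makes sense.\<close>

definition conditioned_density :: "'e \<Rightarrow> real \<Rightarrow> real \<Rightarrow> (real \<Rightarrow> 'e) \<Rightarrow> real" where
  "conditioned_density x a t \<omega> =
     exp (- path_integral \<beta> a \<omega>) * fk_mass P \<beta> (t - a) (\<omega> a) / fk_mass P \<beta> t x"

lemma rn_version_conditioned:
  assumes "x \<in> E" "0 \<le> a" "a \<le> t"
  shows "rn_version_on (path_filtration E (ennreal a)) (P x) (PB E P \<beta> x t) (conditioned_density x a t)"
  using rn_version_PB[OF markov \<beta> assms(1,2), of "t - a"] assms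
  unfolding conditioned_density_def[abs_def] by simp

text \<open>The exponentials in \<open>l0\<close> from the two masses cancel except for
  \<open>exp (l0 * a)\<close>. The time \<open>t\<close> survives only in the quotient of the two
  means, and the prefactor is the ground density with \<open>\<phi>0 x\<close> for
  \<open>\<phi>0 (\<omega> 0)\<close>.\<close>

lemma conditioned_density_eq:
  assumes x: "x \<in> E" and a: "0 \<le> a" "a \<le> t" and \<omega>: "\<omega> \<in> cadlag_paths E"
  shows "conditioned_density x a t \<omega> =
    \<phi>0 (\<omega> a) / \<phi>0 x * (exp (l0 * a) * exp (- path_integral \<beta> a \<omega>)) * (inv_mean (t - a) (\<omega> a) / inv_mean t x)"
proof -
  have "exp (- l0 * (t - a)) = exp (l0 * a) * exp (- l0 * t)"
    by (simp add: exp_add[symmetric] algebra_simps)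
  then show ?thesis
    using fk_mass_eq_inv_mean[OF x, of t] fk_mass_eq_inv_mean[OF cadlag_paths_in[OF \<omega> a(1)], of "t - a"] a
    by (simp add: conditioned_density_def)
qed

lemma conditioned_density_tendsto:
  assumes x: "x \<in> E" and a: "0 \<le> a" and \<omega>: "\<omega> \<in> cadlag_paths E" "\<omega> 0 = x"
  shows "((\<lambda>t. conditioned_density x a t \<omega>) \<longlongrightarrow> ground_density a \<omega>) at_top"
proof -
  let ?c = "\<integral>z. 1 / \<phi>0 z \<partial>\<pi>"
  let ?k = "\<phi>0 (\<omega> a) / \<phi>0 x * (exp (l0 * a) * exp (- path_integral \<beta> a \<omega>))"
  have "filterlim (\<lambda>t. t - a) at_top at_top"
    using filterlim_tendsto_add_at_top[OF tendsto_const filterlim_ident, of "- a"] by simp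
  \<comment> \<open>The path is fixed, so convergence from the single starting point
    \<open>\<omega> a\<close> suffices; both means then share the limit \<open>?c\<close>, and their
    quotient tends to 1.\<close>
  from filterlim_compose[OF inv_mean_tendsto[OF cadlag_paths_in[OF \<omega>(1) a]] this]
  have "((\<lambda>t. inv_mean (t - a) (\<omega> a)) \<longlongrightarrow> ?c) at_top" .
  then have "((\<lambda>t. ?k * (inv_mean (t - a) (\<omega> a) / inv_mean t x)) \<longlongrightarrow> ?k * (?c / ?c)) at_top"
    using stationary_inverse_pos by (intro tendsto_intros inv_mean_tendsto x) auto
  also have "?k * (?c / ?c) = ground_density a \<omega>"
    using stationary_inverse_pos ground_density_eq[OF a \<omega>(1)] \<omega>(2) by simp
  finally show ?thesis
    by (rule Lim_transform_eventually)
       (rule eventually_mono[OF eventually_ge_at_top[of a]], simp only: conditioned_density_eq x a \<omega>(1))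
qed

lemma conditioned_density_bounded:
  assumes x: "x \<in> E" and a: "0 \<le> a"
  obtains B where "\<forall>t\<ge>a. \<forall>\<omega>\<in>cadlag_paths E. \<bar>conditioned_density x a t \<omega>\<bar> \<le> B"
proof -
  obtain b where b: "\<forall>t\<ge>0. \<forall>\<omega>\<in>cadlag_paths E. \<bar>path_integral \<beta> t \<omega>\<bar> \<le> b * t"
    using path_integral_le_linear[OF \<beta>] by blast
  note C2 = C2_pos[OF x]
  \<comment> \<open>The three factors bound the ratio of the values of \<open>\<phi>0\<close>, the
    exponentials at the fixed time \<open>a\<close>, and the quotient of means, whose numerator is
    at most \<open>1 / C1\<close> and denominator at least \<open>1 / C2\<close>.\<close>
  let ?B = "C2 / C1 * (exp (l0 * a) * exp (b * a)) * ((1 / C1) / (1 / C2))"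
  have "\<bar>conditioned_density x a t \<omega>\<bar> \<le> ?B" if t: "a \<le> t" and \<omega>: "\<omega> \<in> cadlag_paths E" for t \<omega>
  proof -
    note y = cadlag_paths_in[OF \<omega> a]
    have pos: "0 < inv_mean t x" "0 < inv_mean (t - a) (\<omega> a)"
      using inv_mean_bounds(1)[OF x, of t] inv_mean_bounds(1)[OF y, of "t - a"] C2 a t
        divide_pos_pos[OF zero_less_one C2] by linarith+
    have "exp (- path_integral \<beta> a \<omega>) \<le> exp (b * a)" using b a \<omega> by (force simp: abs_le_iff)
    then have "conditioned_density x a t \<omega> \<le> ?B"
      unfolding conditioned_density_eq[OF x a t \<omega>]
      using pos \<phi>0_pos[OF x] \<phi>0_pos[OF y] C1_le[OF x] le_C2[OF y] C1_pos C2 a t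
        inv_mean_bounds(1)[OF x, of t] inv_mean_bounds(2)[OF y, of "t - a"]
      by (intro mult_mono frac_le mult_nonneg_nonneg divide_nonneg_nonneg) auto
    moreover have "0 \<le> conditioned_density x a t \<omega>"
      unfolding conditioned_density_def by (simp add: fk_mass_nonneg)
    ultimately show ?thesis by simp
  qed
  then show thesis using that by blast
qed

section \<open>Almost sure and L1 convergence\<close>

lemma AE_conditioned_tendsto:
  assumes x: "x \<in> E" and a: "0 \<le> a"
  shows "AE \<omega> in P x. ((\<lambda>t. conditioned_density x a t \<omega>) \<longlongrightarrow> ground_density a \<omega>) at_top"
  using markov_AE_initial[OF markov x] AE_space
  by eventually_elim (rule conditioned_density_tendsto[OF x a], simp_all add: markov_space[OF markov x])

lemma AE_rn_on_ground:
  assumes x: "x \<in> E" and a: "0 \<le> a"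
  shows "AE \<omega> in P x. rn_on (path_filtration E (ennreal a)) (P x) (P\<phi> x) \<omega> = ground_density a \<omega>"
proof -
  interpret prob_space "P x" by (rule markov_prob_space[OF markov x])
  show ?thesis by (rule rn_on_eq_version[OF markov_subalgebra[OF markov x] rn_version_ground[OF x a]])
qed

text \<open>The family in \<open>t\<close> consists of the explicit versions; only the limit
  derivative is exchanged for \<open>ground_density\<close>, at the cost of a single null
  set.\<close>

lemma rn_converges_AE_ground:
  assumes x: "x \<in> E" and a: "0 \<le> a"
  shows "rn_converges_AE (path_filtration E (ennreal a)) (P x) a (PB E P \<beta> x) (P\<phi> x)"
  unfolding rn_converges_AE_def
proof (intro exI conjI allI impI)
  show "rn_version_on (path_filtration E (ennreal a)) (P x) (PB E P \<beta> x t) (conditioned_density x a t)"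
    if "a \<le> t" for t
    using x a that by (rule rn_version_conditioned)
  show "AE \<omega> in P x. ((\<lambda>t. conditioned_density x a t \<omega>) \<longlongrightarrow>
      rn_on (path_filtration E (ennreal a)) (P x) (P\<phi> x) \<omega>) at_top"
    using AE_conditioned_tendsto[OF x a] AE_rn_on_ground[OF x a] by eventually_elim simp
qed

text \<open>The integrals do not see the choice of versions, so for each \<open>t\<close> separately
  the derivatives may be replaced by the explicit densities, to which dominated convergence
  applies.\<close>

lemma rn_converges_L1_ground:
  assumes x: "x \<in> E" and a: "0 \<le> a"
  shows "rn_converges_L1 (path_filtration E (ennreal a)) (P x) a (PB E P \<beta> x) (P\<phi> x)"
proof -
  interpret prob_space "P x" by (rule markov_prob_space[OF markov x])
  let ?F = "path_filtration E (ennreal a)"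
  let ?Z = "conditioned_density x a" and ?G = "ground_density a"
  let ?rn = "\<lambda>t. rn_on ?F (P x) (PB E P \<beta> x t)" and ?rn' = "rn_on ?F (P x) (P\<phi> x)"
  note sub = markov_subalgebra[OF markov x]
  obtain B where B: "\<forall>t\<ge>a. \<forall>\<omega>\<in>cadlag_paths E. \<bar>?Z t \<omega>\<bar> \<le> B"
    using conditioned_density_bounded[OF x a] by blast
  have Zm: "?Z t \<in> borel_measurable (P x)" if "a \<le> t" for t
    using rn_version_conditioned[OF x a that] markov_measurable[OF markov x] by (auto simp: rn_version_on_def)
  have Gm: "?G \<in> borel_measurable (P x)"
    by (rule markov_measurable[OF markov x measurable_ground_density[OF a]])
  have ae: "AE \<omega> in P x. ?rn t \<omega> = ?Z t \<omega>" if "a \<le> t" for t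
    by (rule rn_on_eq_version[OF sub rn_version_conditioned[OF x a that]])
  note ae' = AE_rn_on_ground[OF x a]
  have Zi: "integrable (P x) (?Z t)" if "a \<le> t" for t
    using B that by (intro integrable_markov_bounded[where B=B, OF markov x Zm]) auto
  \<comment> \<open>The uniform bound passes to the almost sure limit.\<close>
  have G_le: "AE \<omega> in P x. \<bar>?G \<omega>\<bar> \<le> B"
    using AE_conditioned_tendsto[OF x a] AE_space
  proof eventually_elim
    case (elim \<omega>)
    then show ?case
      using B
      by (intro tendsto_upperbound[OF tendsto_rabs[OF elim(1)]]
            eventually_mono[OF eventually_ge_at_top[of a]])
         (auto simp: markov_space[OF markov x])
  qed
  then have Gi: "integrable (P x) ?G"
    by (intro integrable_const_bound[where B=B]) (auto simp: Gm)
  \<comment> \<open>Measurability is required for every real \<open>t\<close> but known only from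
    \<open>a\<close> on, hence \<open>max a t\<close>. The dominating constant \<open>2 * B\<close>
    adds the bounds of the two densities.\<close>
  have "((\<lambda>t. \<integral>\<omega>. \<bar>?Z (max a t) \<omega> - ?G \<omega>\<bar> \<partial>P x) \<longlongrightarrow> (\<integral>\<omega>. 0 \<partial>P x)) at_top"
  proof (rule integral_dominated_convergence_at_top[where w="\<lambda>_. 2 * B"])
    show "AE \<omega> in P x. ((\<lambda>t. \<bar>?Z (max a t) \<omega> - ?G \<omega>\<bar>) \<longlongrightarrow> 0) at_top"
      using AE_conditioned_tendsto[OF x a]
    proof eventually_elim
      case (elim \<omega>)
      have "((\<lambda>t. ?Z (max a t) \<omega>) \<longlongrightarrow> ?G \<omega>) at_top"
        by (rule Lim_transform_eventually[OF elim])
           (rule eventually_mono[OF eventually_ge_at_top[of a]], simp add: max_def)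
      then show ?case by (intro tendsto_rabs_zero) (simp add: LIM_zero)
    qed
    show "\<forall>\<^sub>F t in at_top. AE \<omega> in P x. norm \<bar>?Z (max a t) \<omega> - ?G \<omega>\<bar> \<le> 2 * B"
    proof (rule always_eventually, rule allI)
      fix t
      show "AE \<omega> in P x. norm \<bar>?Z (max a t) \<omega> - ?G \<omega>\<bar> \<le> 2 * B"
        using G_le AE_space
      proof eventually_elim
        case (elim \<omega>)
        have "\<bar>?Z (max a t) \<omega>\<bar> \<le> B" using B elim(2) by (simp add: markov_space[OF markov x])
        with elim(1) show ?case by simp
      qed
    qed
    show "(\<lambda>\<omega>. \<bar>?Z (max a t) \<omega> - ?G \<omega>\<bar>) \<in> borel_measurable (P x)" for t
      by (intro borel_measurable_abs borel_measurable_diff Zm Gm) simp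
  qed simp_all
  then have lim: "((\<lambda>t. \<integral>\<omega>. \<bar>?Z (max a t) \<omega> - ?G \<omega>\<bar> \<partial>P x) \<longlongrightarrow> 0) at_top" by simp
  \<comment> \<open>The exceptional null set may depend on \<open>t\<close>, which is harmless for
    integrals taken at one \<open>t\<close> at a time.\<close>
  have eq: "(\<integral>\<omega>. \<bar>?Z (max a t) \<omega> - ?G \<omega>\<bar> \<partial>P x) = (\<integral>\<omega>. \<bar>?rn t \<omega> - ?rn' \<omega>\<bar> \<partial>P x)" if t: "a \<le> t" for t
  proof (rule integral_cong_AE)
    show "AE \<omega> in P x. \<bar>?Z (max a t) \<omega> - ?G \<omega>\<bar> = \<bar>?rn t \<omega> - ?rn' \<omega>\<bar>"
      using ae[OF t] ae' by eventually_elim (use t in \<open>simp add: max_def\<close>)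
  qed (use Zm Gm measurable_rn_on[OF sub] in auto)
  show ?thesis
    unfolding rn_converges_L1_def
  proof (intro conjI allI impI)
    show "integrable (P x) (?rn t)" if "a \<le> t" for t
      using Zi[OF that] integrable_cong_AE[OF measurable_rn_on[OF sub] Zm[OF that] ae[OF that]] by simp
    show "integrable (P x) ?rn'"
      using Gi integrable_cong_AE[OF measurable_rn_on[OF sub] Gm ae'] by simp
    show "((\<lambda>t. \<integral>\<omega>. \<bar>?rn t \<omega> - ?rn' \<omega>\<bar> \<partial>P x) \<longlongrightarrow> 0) at_top"
      by (rule Lim_transform_eventually[OF lim])
         (rule eventually_mono[OF eventually_ge_at_top[of a] eq])
  qed
qed

end

section \<open>The common statement and its two instances\<close>

lemma rn_converges_ground_transform:
  assumes "strong_markov E P" "\<beta> \<in> Cb E" "hyp_H8 E P \<phi>0"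
    "is_ground_transform E P \<beta> l0 \<phi>0 P\<phi>" "hyp_H9 E P\<phi> \<pi>" "x \<in> E" "0 \<le> t0"
  shows "rn_converges_AE (path_filtration E (ennreal t0)) (P x) t0 (PB E P \<beta> x) (P\<phi> x) \<and>
    rn_converges_L1 (path_filtration E (ennreal t0)) (P x) t0 (PB E P \<beta> x) (P\<phi> x)"
proof -
  \<comment> \<open>Membership in the generator domain includes that \<open>\<phi>0\<close> is
    bounded and continuous.\<close>
  from assms(3) obtain C1 C2 where "\<phi>0 \<in> Cb E" "0 < C1" "\<forall>x\<in>E. C1 \<le> \<phi>0 x \<and> \<phi>0 x \<le> C2"
    by (auto simp: hyp_H8_def generator_domain_def is_generator_def)
  then interpret ground_state_process E P \<beta> l0 \<phi>0 P\<phi> \<pi> C1 C2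
    using assms by unfold_locales auto
  show ?thesis
    using rn_converges_AE_ground rn_converges_L1_ground assms(6,7) by blast
qed

theorem lemma6p13:
  shows "(\<forall>(K::nat) P \<beta> l0 \<phi>0 P\<phi> \<pi>.
       irreducible_chain K P \<and> Cb_feller {1..K} P \<and> \<beta> \<in> Cb {1..K} \<and>
       ground_state {1..K} P \<beta> l0 \<phi>0 \<and> hyp_H8 {1..K} P \<phi>0 \<and>
       is_ground_transform {1..K} P \<beta> l0 \<phi>0 P\<phi> \<and> hyp_H9 {1..K} P\<phi> \<pi> \<longrightarrow>
       (\<forall>x\<in>{1..K}. \<forall>t0\<ge>0.
          rn_converges_AE (path_filtration {1..K} (ennreal t0)) (P x) t0 (PB {1..K} P \<beta> x) (P\<phi> x) \<and>
          rn_converges_L1 (path_filtration {1..K} (ennreal t0)) (P x) t0 (PB {1..K} P \<beta> x) (P\<phi> x)))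
   \<and> (\<forall>(E :: (real ^ 'k) set) \<mu> a b P \<beta> l0 \<phi>0 P\<phi> \<pi>.
       diffusion_on E \<mu> a b P \<and> Cb_feller E P \<and> \<beta> \<in> Cb E \<and>
       ground_state E P \<beta> l0 \<phi>0 \<and> hyp_H8 E P \<phi>0 \<and>
       is_ground_transform E P \<beta> l0 \<phi>0 P\<phi> \<and> hyp_H9 E P\<phi> \<pi> \<longrightarrow>
       (\<forall>x\<in>E. \<forall>t0\<ge>0.
          rn_converges_AE (path_filtration E (ennreal t0)) (P x) t0 (PB E P \<beta> x) (P\<phi> x) \<and>
          rn_converges_L1 (path_filtration E (ennreal t0)) (P x) t0 (PB E P \<beta> x) (P\<phi> x)))"
  \<comment> \<open>Both classes of processes are strong Markov by definition, so each half is an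
    instance of the common statement.\<close>
  by (rule conjI; intro allI impI ballI; elim conjE; rule rn_converges_ground_transform)
     (auto simp: irreducible_chain_def diffusion_on_def)

end
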